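(* The Shortest Path Discovery problem in the token sliding model is fixed-parameter tractable with respect to the parameter $k$. The problem: given a graph $G$, vertices $s,t\in V(G)$, a vertex set $S\subseteq V(G)$ whose size $k$ equals the number of vertices (including $s$ and $t$) of a shortest $s$-$t$-path, and a non-negative integer $b$, decide whether there is a discovery sequence $C_0\dots C_\ell$ in the token sliding model with $C_0=S$, $\ell\le b$, and $C_\ell$ the vertex set of a shortest $s$-$t$-path.
   Context: A configuration is a set of vertices (one token on each). In the token sliding model, $C'$ is obtained in one step from $C$ if $C'=(C\setminus\{y\})\cup\{x\}$ with $y\in C$, $x\notin C$, $xy\in E(G)$. A discovery sequence of length $\ell$ is a sequence $C_0\dots C_\ell$ with each $C_{i+1}$ obtained in one step from $C_i$. Fixed-parameter tractable means solvable in time $f(k)\cdot N^{c}$ for a computable $f$, constant $c$, and input size $N$. *)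

theory Defs
  imports
    "HOL-Library.Log_Nat"
    "Graph_Theory.Pair_Digraph"
    "Graph_Theory.Vertex_Walk"
begin

section \<open>Solution discovery for shortest paths\<close>

text \<open>
  Finite simple undirected graphs are the graphs of \<^locale>\<open>pair_graph\<close>: finite, loopfree, and
  with a symmetric set of arcs.
\<close>

definition st_path :: "'a pair_pre_digraph \<Rightarrow> 'a \<Rightarrow> 'a \<Rightarrow> 'a list \<Rightarrow> bool" where
  "st_path G s t p \<longleftrightarrow> vpath p (with_proj G) \<and> hd p = s \<and> last p = t"

definition shortest_st_path :: "'a pair_pre_digraph \<Rightarrow> 'a \<Rightarrow> 'a \<Rightarrow> 'a list \<Rightarrow> bool" where
  "shortest_st_path G s t p \<longleftrightarrow>
     st_path G s t p \<and> (\<forall>q. st_path G s t q \<longrightarrow> vwalk_length p \<le> vwalk_length q)"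

definition slide :: "'a pair_pre_digraph \<Rightarrow> 'a set \<Rightarrow> 'a set \<Rightarrow> bool" where
  "slide G C C' \<longleftrightarrow>
     (\<exists>x y. y \<in> C \<and> x \<notin> C \<and> (x, y) \<in> parcs G \<and> C' = (C - {y}) \<union> {x})"

text \<open>Only the values \<open>C 0, \<dots>, C l\<close> are relevant.\<close>

definition discovery_sequence :: "'a pair_pre_digraph \<Rightarrow> (nat \<Rightarrow> 'a set) \<Rightarrow> nat \<Rightarrow> bool" where
  "discovery_sequence G C l \<longleftrightarrow>
     (\<forall>i\<le>l. C i \<subseteq> pverts G) \<and> (\<forall>i<l. slide G (C i) (C (Suc i)))"

record 'a spd =
  graph_of :: "'a pair_pre_digraph"
  source :: 'a
  target :: 'a
  start :: "'a set"
  budget :: nat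

definition spd_instance :: "'a spd \<Rightarrow> bool" where
  "spd_instance I \<longleftrightarrow>
     pair_graph (graph_of I) \<and>
     source I \<in> pverts (graph_of I) \<and> target I \<in> pverts (graph_of I) \<and>
     start I \<subseteq> pverts (graph_of I) \<and>
     (\<exists>p. shortest_st_path (graph_of I) (source I) (target I) p \<and> card (start I) = length p)"

definition spd_parameter :: "'a spd \<Rightarrow> nat" where
  "spd_parameter I = card (start I)"

definition spd_yes :: "'a spd \<Rightarrow> bool" where
  "spd_yes I \<longleftrightarrow>
     (\<exists>C l. discovery_sequence (graph_of I) C l \<and> C 0 = start I \<and> l \<le> budget I \<and>
        (\<exists>p. shortest_st_path (graph_of I) (source I) (target I) p \<and> C l = set p))"


section \<open>Random access machines\<close>

text \<open>
  The machine model is the random access machine with addition and truncated subtraction under the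
  uniform cost measure, with its programs written in structured form. It has scalar registers and
  arrays, both named by natural numbers; a program mentions only finitely many of them. There is no
  multiplication, so \<open>t\<close> steps of a fixed program lengthen the binary representation of the stored
  numbers by \<open>O(t)\<close> bits only, and running times agree with those of Turing machines up to
  polynomials.
\<close>

datatype expr =
    Const nat
  | Reg nat
  | Cell nat expr  \<comment> \<open>array name, index\<close>
  | Add expr expr
  | Sub expr expr

datatype prog =
    Skip
  | Assign nat expr
  | Store nat expr expr  \<comment> \<open>array name, index, new entry\<close>
  | Seq prog prog
  | Cond expr prog prog
  | While expr prog

record state =
  reg :: "nat \<Rightarrow> nat"
  arr :: "nat \<Rightarrow> nat \<Rightarrow> nat"

primrec val :: "state \<Rightarrow> expr \<Rightarrow> nat" where
  "val \<sigma> (Const n) = n"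
| "val \<sigma> (Reg x) = reg \<sigma> x"
| "val \<sigma> (Cell a e) = arr \<sigma> a (val \<sigma> e)"
| "val \<sigma> (Add d e) = val \<sigma> d + val \<sigma> e"
| "val \<sigma> (Sub d e) = val \<sigma> d - val \<sigma> e"

primrec cost :: "expr \<Rightarrow> nat" where
  "cost (Const n) = 1"
| "cost (Reg x) = 1"
| "cost (Cell a e) = 1 + cost e"
| "cost (Add d e) = 1 + cost d + cost e"
| "cost (Sub d e) = 1 + cost d + cost e"

text \<open>
  \<open>exec c \<sigma> t \<tau>\<close>: started in state \<open>\<sigma>\<close>, the program \<open>c\<close> halts after exactly \<open>t\<close> steps in state \<open>\<tau>\<close>.
  A condition holds if its value is nonzero.
\<close>

inductive exec :: "prog \<Rightarrow> state \<Rightarrow> nat \<Rightarrow> state \<Rightarrow> bool" where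
  Skip: "exec Skip \<sigma> 1 \<sigma>"
| Assign: "exec (Assign x e) \<sigma> (1 + cost e) (\<sigma>\<lparr>reg := (reg \<sigma>)(x := val \<sigma> e)\<rparr>)"
| Store: "exec (Store a d e) \<sigma> (1 + cost d + cost e)
            (\<sigma>\<lparr>arr := (arr \<sigma>)(a := (arr \<sigma> a)(val \<sigma> d := val \<sigma> e))\<rparr>)"
| Seq: "exec c \<sigma> t \<sigma>' \<Longrightarrow> exec d \<sigma>' u \<sigma>'' \<Longrightarrow> exec (Seq c d) \<sigma> (t + u) \<sigma>''"
| CondTrue: "val \<sigma> e \<noteq> 0 \<Longrightarrow> exec c \<sigma> t \<sigma>' \<Longrightarrow> exec (Cond e c d) \<sigma> (1 + cost e + t) \<sigma>'"
| CondFalse: "val \<sigma> e = 0 \<Longrightarrow> exec d \<sigma> t \<sigma>' \<Longrightarrow> exec (Cond e c d) \<sigma> (1 + cost e + t) \<sigma>'"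
| WhileFalse: "val \<sigma> e = 0 \<Longrightarrow> exec (While e c) \<sigma> (1 + cost e) \<sigma>"
| WhileTrue: "val \<sigma> e \<noteq> 0 \<Longrightarrow> exec c \<sigma> t \<sigma>' \<Longrightarrow> exec (While e c) \<sigma>' u \<sigma>'' \<Longrightarrow>
    exec (While e c) \<sigma> (1 + cost e + t + u) \<sigma>''"

text \<open>
  The input, a list of numbers, is given in array 0 and its length in register 0; everything else is
  initially 0. The output is read off from register 0.
\<close>

definition init :: "nat list \<Rightarrow> state" where
  "init xs =
     \<lparr>reg = (\<lambda>_. 0)(0 := length xs),
      arr = (\<lambda>_ _. 0)(0 := (\<lambda>i. if i < length xs then xs ! i else 0))\<rparr>"

definition result :: "state \<Rightarrow> nat" where
  "result \<sigma> = reg \<sigma> 0"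

definition computable :: "(nat \<Rightarrow> nat) \<Rightarrow> bool" where
  "computable f \<longleftrightarrow> (\<exists>c. \<forall>n. \<exists>t \<sigma>. exec c (init [n]) t \<sigma> \<and> result \<sigma> = f n)"


section \<open>Fixed-parameter tractability\<close>

text \<open>The size of an input is the length of its binary notation, with a separator per entry.\<close>

definition input_size :: "nat list \<Rightarrow> nat" where
  "input_size xs = (\<Sum>x\<leftarrow>xs. 1 + floorlog 2 x)"

text \<open>
  A parameterized decision problem is given by its instances, their encoding as inputs, the
  parameter, and the set of yes-instances. Nothing is required of a decision procedure on inputs
  that do not encode an instance.
\<close>

definition fixed_parameter_tractable ::
    "('i \<Rightarrow> bool) \<Rightarrow> ('i \<Rightarrow> nat list) \<Rightarrow> ('i \<Rightarrow> nat) \<Rightarrow> ('i \<Rightarrow> bool) \<Rightarrow> bool" where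
  "fixed_parameter_tractable inst enc \<kappa> yes \<longleftrightarrow>
     (\<exists>P f c. computable f \<and>
        (\<forall>I. inst I \<longrightarrow>
           (\<exists>t \<sigma>. exec P (init (enc I)) t \<sigma> \<and>
              t \<le> f (\<kappa> I) * input_size (enc I) ^ c \<and>
              result \<sigma> = (if yes I then 1 else 0))))"

text \<open>
  As inputs, graphs have the vertex set \<open>{0..<n}\<close> and are encoded by their adjacency matrix, listed
  row by row; the set of tokens is encoded by its characteristic vector.
\<close>

definition spd_input :: "nat spd \<Rightarrow> bool" where
  "spd_input I \<longleftrightarrow> spd_instance I \<and> (\<exists>n. pverts (graph_of I) = {0..<n})"

definition spd_encode :: "nat spd \<Rightarrow> nat list" where
  "spd_encode I =
     (let n = card (pverts (graph_of I)) in
        [n] @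
        [of_bool ((u, v) \<in> parcs (graph_of I)). u \<leftarrow> [0..<n], v \<leftarrow> [0..<n]] @
        [source I, target I] @
        [of_bool (v \<in> start I). v \<leftarrow> [0..<n]] @
        [budget I])"

end

theory Submission
  imports Defs
begin

text \<open>
  Since tokens are indistinguishable, a token that is in the way can exchange its destination with
  the token it blocks, so a target set \<open>T\<close> is reachable within \<open>b\<close> steps iff there is a bijection
  from the tokens to \<open>T\<close> of total distance at most \<open>b\<close>. A walk from \<open>s\<close> to \<open>t\<close> on \<open>k\<close> vertices is
  automatically a shortest path. It remains to minimize, over such walks and assignments of the
  tokens to their vertices, the total distance. This is done by dynamic programming along the walk,
  remembering the set of tokens used so far. The set is recorded as the sum of the weights
  \<open>2\<^sup>k + 2\<^sup>i\<close> of its elements, where \<open>i\<close> is the rank of a token: a multiset of tokens whose weight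
  equals the total weight \<open>(k + 1) 2\<^sup>k - 1\<close> contains every token exactly once. Thus neither membership
  in the set nor the number of vertices has to be checked, and the table has at most
  \<open>4\<^sup>k\<close> relevant rows.
\<close>

section \<open>Matchings and discovery sequences\<close>

lemma discovery_sequence_Cons:
  assumes "slide G A (C 0)" "A \<subseteq> pverts G" "discovery_sequence G C l"
  shows "discovery_sequence G (\<lambda>i. case i of 0 \<Rightarrow> A | Suc j \<Rightarrow> C j) (Suc l)"
  using assms unfolding discovery_sequence_def by (auto split: nat.split simp: less_Suc_eq_0_disj)

text \<open>Induction on the total distance, over all matchings at once. If some vertex of
  \<open>T\<close> is free, the last token on the walk towards it slides one step, after an exchange
  of destinations where necessary, and the total drops. Otherwise equal cardinality gives
  \<open>T = S\<close>.\<close>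

lemma matching_imp_discovery_sequence:
  assumes "sym (parcs G)" "parcs G \<subseteq> pverts G \<times> pverts G"
    and "finite S" "S \<subseteq> pverts G" "bij_betw \<phi> S T" "\<forall>u\<in>S. (u, \<phi> u) \<in> parcs G ^^ d u"
  shows "\<exists>C l. discovery_sequence G C l \<and> C 0 = S \<and> C l = T \<and> l \<le> sum d S"
  using assms(3-)
proof (induction "sum d S" arbitrary: S \<phi> d rule: less_induct)
  case less
  show ?case
  proof (cases "T \<subseteq> S")
    case True
    with less.prems have "T = S"
      by (metis bij_betw_same_card card_subset_eq)
    then have "discovery_sequence G (\<lambda>_. S) 0"
      using less.prems by (auto simp: discovery_sequence_def)
    with \<open>T = S\<close> show ?thesis by fastforce
  next
    case False
    then obtain z where z: "z \<in> T" "z \<notin> S" by blast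
    with less.prems(3) obtain a where a: "a \<in> S" "\<phi> a = z"
      by (metis bij_betw_imp_surj_on imageE)
    \<comment> \<open>The token closest to \<open>z\<close> on a walk from \<open>a\<close> to \<open>z\<close> can move, and takes over the destination \<open>z\<close>.\<close>
    define P where "P j \<longleftrightarrow> (\<exists>u i. u \<in> S \<and> (a, u) \<in> parcs G ^^ i \<and> (u, z) \<in> parcs G ^^ j
      \<and> i + j = d a)" for j
    have "P (d a)"
      unfolding P_def using a less.prems(4) by (intro exI[of _ a] exI[of _ 0]) auto
    then have Pmin: "P (LEAST j. P j)" by (rule LeastI)
    define m where "m = (LEAST j. P j)"
    from Pmin obtain u i where u: "u \<in> S" "(a, u) \<in> parcs G ^^ i" "(u, z) \<in> parcs G ^^ m"
      "i + m = d a" unfolding P_def m_def by blast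
    have "m \<noteq> 0" using u z by (cases m) auto
    then obtain j where j: "m = Suc j" by (cases m) auto
    with u(3) obtain x where x: "(u, x) \<in> parcs G" "(x, z) \<in> parcs G ^^ j"
      by (meson relpow_Suc_D2)
    have xS: "x \<notin> S"
    proof
      assume "x \<in> S"
      then have "P j" unfolding P_def using u x j
        by (intro exI[of _ x] exI[of _ "Suc i"]) auto
      then show False using Least_le[of P j] j m_def by simp
    qed
    define S' where "S' = (S - {u}) \<union> {x}"
    \<comment> \<open>The moved token, now on \<open>x\<close>, heads for \<open>z\<close>. If it is
      not the token of \<open>a\<close>, the latter walks from \<open>a\<close> to \<open>u\<close>
      and on to the old destination of \<open>u\<close>. For \<open>a = u\<close> the middle case is
      never met on \<open>S'\<close>.\<close>
    define \<psi> where "\<psi> = (\<lambda>y. if y = x then z else if y = a then \<phi> u else \<phi> y)"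
    define e where "e = (\<lambda>y. if y = x then j else if y = a then i + d u else d y)"
    have S': "S' \<subseteq> pverts G" "finite S'"
      using less.prems assms(2) x by (auto simp: S'_def)
    have ne: "x \<noteq> a" "x \<noteq> u" using xS a u by auto
    have bij: "bij_betw \<psi> S' T"
    proof -
      have inj: "inj_on \<phi> S" and im: "\<phi> ` S = T"
        using less.prems(3) by (auto simp: bij_betw_def)
      have "inj_on \<psi> S'"
        using inj a u xS unfolding inj_on_def S'_def \<psi>_def by (auto split: if_splits)
      moreover have "\<psi> ` S' \<subseteq> T"
        using im a u by (auto simp: S'_def \<psi>_def split: if_splits)
      moreover have "card S' = card S"
        using less.prems(1) u xS
          by (simp add: S'_def card.insert_remove card_gt_0_iff) (metis card_gt_0_iff empty_iff Suc_pred)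
      moreover have "card T = card S" using im inj card_image by blast
      ultimately show ?thesis
        using less.prems(1) im S'(2)
        by (metis bij_betw_imageI card_image card_subset_eq finite_imageI)
    qed
    have walks: "\<forall>y\<in>S'. (y, \<psi> y) \<in> parcs G ^^ e y"
      using less.prems(4) u x by (auto simp: S'_def \<psi>_def e_def relpow_add)
    have lt: "sum e S' < sum d S"
    proof -
      have eS: "sum e S' = j + sum e (S - {u})"
        using less.prems(1) xS by (simp add: S'_def e_def)
      have dS: "sum d S = d u + sum d (S - {u})"
        using less.prems(1) u by (simp add: sum.remove)
      show ?thesis
      proof (cases "a = u")
        case True
        then have "sum e (S - {u}) = sum d (S - {u})"
          using xS by (intro sum.cong) (auto simp: e_def)
        then show ?thesis using eS dS u j True by simp
      next
        case False
        have "sum e (S - {u} - {a}) = sum d (S - {u} - {a})"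
          using xS by (intro sum.cong) (auto simp: e_def)
        then have "sum e (S - {u}) = i + d u + sum d (S - {u} - {a})"
          using less.prems(1) a False ne by (subst sum.remove[of _ a]) (auto simp: e_def)
        moreover have "sum d (S - {u}) = d a + sum d (S - {u} - {a})"
          using less.prems(1) a False by (subst sum.remove[of _ a]) auto
        ultimately show ?thesis using eS dS u j by simp
      qed
    qed
    from less.hyps[OF lt S'(2,1) bij walks] obtain C l where
      C: "discovery_sequence G C l" "C 0 = S'" "C l = T" "l \<le> sum e S'" by blast
    have "(x, u) \<in> parcs G" using x assms(1) by (meson symD)
    then have "slide G S (C 0)"
      unfolding slide_def using u xS C(2) S'_def by blast
    from discovery_sequence_Cons[OF this less.prems(2) C(1)] show ?thesis
      using C lt by (intro exI[of _ "\<lambda>i. case i of 0 \<Rightarrow> S | Suc j \<Rightarrow> C j"] exI[of _ "Suc l"]) auto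
  qed
qed

text \<open>Each token is followed along the sequence: a slide appends one arc to the walk of the
  single token that moves, so every slide pays for one unit of total distance.\<close>

lemma discovery_sequence_imp_matching:
  assumes "sym (parcs G)" "finite S" "discovery_sequence G C l" "C 0 = S"
  shows "\<exists>\<phi> d. bij_betw \<phi> S (C l) \<and> (\<forall>u\<in>S. (u, \<phi> u) \<in> parcs G ^^ d u) \<and> sum d S \<le> l"
  using assms(3)
proof (induction l)
  case 0
  show ?case using assms(4) by (intro exI[of _ id] exI[of _ "\<lambda>_. 0"]) (auto simp: bij_betw_def)
next
  case (Suc l)
  then have "discovery_sequence G C l" and sl: "slide G (C l) (C (Suc l))"
    by (auto simp: discovery_sequence_def)
  with Suc.IH obtain \<phi> d where
    IH: "bij_betw \<phi> S (C l)" "\<forall>u\<in>S. (u, \<phi> u) \<in> parcs G ^^ d u" "sum d S \<le> l" by blast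
  from sl obtain x y where xy: "y \<in> C l" "x \<notin> C l" "(x, y) \<in> parcs G"
    "C (Suc l) = (C l - {y}) \<union> {x}" by (auto simp: slide_def)
  from IH(1) xy(1) obtain a where a: "a \<in> S" "\<phi> a = y"
    by (metis bij_betw_imp_surj_on imageE)
  have yx: "(y, x) \<in> parcs G" using assms(1) xy(3) by (meson symD)
  have "bij_betw (\<phi>(a := x)) S (C (Suc l))"
  proof -
    have inj: "inj_on \<phi> S" and im: "\<phi> ` S = C l" using IH(1) by (auto simp: bij_betw_def)
    have "inj_on (\<phi>(a := x)) S"
      using inj im xy(2) by (auto simp: inj_on_def)
    moreover have "(\<phi>(a := x)) ` S = C (Suc l)"
      using inj im xy a by (auto simp: inj_on_def image_iff split: if_splits)
    ultimately show ?thesis by (simp add: bij_betw_def)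
  qed
  moreover have "\<forall>u\<in>S. (u, (\<phi>(a := x)) u) \<in> parcs G ^^ (d(a := Suc (d a))) u"
    using IH(2) a yx by auto
  moreover have "sum (d(a := Suc (d a))) S \<le> Suc l"
  proof -
    have "sum (d(a := Suc (d a))) (S - {a}) = sum d (S - {a})"
      by (intro sum.cong) auto
    then show ?thesis using IH(3) a assms(2) by (simp add: sum.remove[of S a])
  qed
  ultimately show ?case by blast
qed

section \<open>Assigning tokens along a walk\<close>

text \<open>A sum of powers of two that is -1 modulo 2^k is treated like binary addition: digit 0 is
  odd, say \<open>2 * q + 1\<close>, and its surplus is carried to digit 1 as \<open>q\<close>. A
  carry replaces 2q summands by q, so the minimum of k summands is attained only without
  carries.\<close>

lemma two_adic_weight:
  fixes m :: "nat \<Rightarrow> nat"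
  assumes "2 ^ k dvd (\<Sum>j<k. m j * 2 ^ j) + 1"
  shows "k \<le> sum m {..<k}" "sum m {..<k} = k \<Longrightarrow> j < k \<Longrightarrow> m j = 1"
proof -
  have "k \<le> sum m {..<k} \<and> (sum m {..<k} = k \<longrightarrow> (\<forall>j<k. m j = 1))"
    using assms
  proof (induction k arbitrary: m)
    case 0
    then show ?case by simp
  next
    case (Suc k)
    define A where "A = (\<Sum>j<k. m (Suc j) * 2 ^ j)"
    have eq: "(\<Sum>j<Suc k. m j * 2 ^ j) = m 0 + 2 * A"
      unfolding A_def by (subst sum.lessThan_Suc_shift) (simp add: sum_distrib_left mult_ac)
    have "2 dvd m 0 + 2 * A + 1"
      using Suc.prems unfolding eq by (rule dvd_trans[rotated]) simp
    then have "odd (m 0)" by simp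
    then obtain q where q: "m 0 = 2 * q + 1" by (rule oddE)
    have "2 * 2 ^ k dvd 2 * (q + A + 1)"
      using Suc.prems unfolding eq q by (simp add: algebra_simps)
    then have dvd: "2 ^ k dvd q + A + 1"
      by (simp only: nat_mult_dvd_cancel_disj) simp
    have shift: "sum m {..<Suc k} = m 0 + (\<Sum>j<k. m (Suc j))"
      by (rule sum.lessThan_Suc_shift)
    show ?case
    proof (cases k)
      case 0
      then show ?thesis using q by simp
    next
      case (Suc k')
      \<comment> \<open>the surplus of digit 0 is carried to digit 1\<close>
      define m' where "m' = (\<lambda>j. m (Suc j) + (if j = 0 then q else 0))"
      have "(\<Sum>j<k. m' j * 2 ^ j) = q + A"
        unfolding m'_def A_def Suc by (simp add: sum.lessThan_Suc_shift del: sum.lessThan_Suc)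
      with Suc.IH[of m'] dvd have IH: "k \<le> sum m' {..<k}"
        "sum m' {..<k} = k \<longrightarrow> (\<forall>j<k. m' j = 1)" by simp_all
      have s: "sum m' {..<k} = q + (\<Sum>j<k. m (Suc j))"
        unfolding m'_def Suc by (simp add: sum.lessThan_Suc_shift del: sum.lessThan_Suc)
      have "\<forall>j<Suc k. m j = 1" if "sum m {..<Suc k} = Suc k"
      proof -
        have "q = 0" "sum m' {..<k} = k" using that IH(1) unfolding shift s q by auto
        moreover have "m' = (\<lambda>j. m (Suc j))" using \<open>q = 0\<close> by (auto simp: m'_def fun_eq_iff)
        ultimately have "\<forall>j<k. m (Suc j) = 1" using IH(2) by simp
        then show ?thesis using q \<open>q = 0\<close> by (auto simp: less_Suc_eq_0_disj)
      qed
      then show ?thesis using IH(1) unfolding shift s q by auto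
    qed
  qed
  then show "k \<le> sum m {..<k}" "sum m {..<k} = k \<Longrightarrow> j < k \<Longrightarrow> m j = 1" by auto
qed

text \<open>The low parts contribute 2^k - 1, so the total is -1 modulo 2^k, as
  \<open>two_adic_weight\<close> requires.\<close>

lemma sum_weights:
  fixes r :: "'a \<Rightarrow> nat"
  assumes "bij_betw r S {..<k}"
  shows "(\<Sum>u\<in>S. 2 ^ k + 2 ^ r u :: nat) + 1 = (k + 1) * 2 ^ k"
proof -
  have "(\<Sum>j<k. 2 ^ j :: nat) + 1 = 2 ^ k"
    by (induction k) simp_all
  then show ?thesis
    using sum.reindex_bij_betw[OF assms, of "\<lambda>j. 2 ^ k + 2 ^ j :: nat"] by (simp add: sum.distrib)
qed

text \<open>The high parts 2^k count the entries of \<open>us\<close>, and the size of the total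
  permits at most k of them. Modulo 2^k only the low parts remain, and they need at least k entries.
  With exactly k, \<open>two_adic_weight\<close> gives every token multiplicity one.\<close>

lemma weight_unique:
  fixes r :: "'a \<Rightarrow> nat"
  assumes r: "bij_betw r S {..<k}" and us: "set us \<subseteq> S"
    and eq: "(\<Sum>u\<leftarrow>us. 2 ^ k + 2 ^ r u) = (\<Sum>u\<in>S. 2 ^ k + 2 ^ r u :: nat)"
  shows "distinct us" "set us = S"
proof -
  have fin: "finite S" and card: "card S = k"
    using r bij_betw_finite bij_betw_same_card by fastforce+
  define m where "m = (\<lambda>j. count_list us (inv_into S r j))"
  have m: "m (r u) = count_list us u" if "u \<in> S" for u
    using that r by (simp add: m_def bij_betw_inv_into_left)
  have reindex: "(\<Sum>u\<in>S. g (r u)) = (\<Sum>j<k. g j)" for g :: "nat \<Rightarrow> nat"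
    using sum.reindex_bij_betw[OF r, of g] by simp
  have "(\<Sum>u\<leftarrow>us. 2 ^ k + 2 ^ r u) = (\<Sum>u\<in>S. m (r u) * (2 ^ k + 2 ^ r u))"
    using sum_list_map_eq_sum_count2[OF us fin] m by (simp cong: sum.cong)
  also have "\<dots> = (\<Sum>j<k. m j * (2 ^ k + 2 ^ j))"
    by (rule reindex)
  also have "\<dots> = sum m {..<k} * 2 ^ k + (\<Sum>j<k. m j * 2 ^ j)"
    by (simp add: algebra_simps sum.distrib sum_distrib_right)
  finally have "(\<Sum>u\<leftarrow>us. 2 ^ k + 2 ^ r u) = sum m {..<k} * 2 ^ k + (\<Sum>j<k. m j * 2 ^ j)" .
  then have total: "sum m {..<k} * 2 ^ k + (\<Sum>j<k. m j * 2 ^ j) + 1 = (k + 1) * 2 ^ k"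
    using eq sum_weights[OF r] by simp
  then have "2 ^ k dvd sum m {..<k} * 2 ^ k + ((\<Sum>j<k. m j * 2 ^ j) + 1)"
    by (metis add.assoc dvd_triv_right)
  then have dvd: "2 ^ k dvd (\<Sum>j<k. m j * 2 ^ j) + 1"
    by (metis dvd_add_right_iff dvd_triv_right)
  have "sum m {..<k} * 2 ^ k < (k + 1) * 2 ^ k"
    using total by linarith
  then have "sum m {..<k} < k + 1" by (simp only: mult_less_cancel2)
  then have sumk: "sum m {..<k} = k"
    using two_adic_weight(1)[OF dvd] by linarith
  then have one: "count_list us u = 1" if "u \<in> S" for u
    using two_adic_weight(2)[OF dvd sumk] m that r by (metis bij_betwE lessThan_iff)
  then show set: "set us = S"
    using us by (metis count_list_0_iff subsetI subset_antisym zero_neq_one)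
  have "length us = (\<Sum>u\<in>S. count_list us u)"
    using sum_count_set[OF us fin] by simp
  also have "\<dots> = card (set us)" using one set by simp
  finally show "distinct us" by (simp add: card_distinct)
qed

text \<open>
  \<open>plan R s S w c v x\<close>: some walk from \<open>s\<close> to \<open>v\<close> can be covered at cost \<open>x\<close> by tokens of total
  weight \<open>c\<close>, where tokens may be used repeatedly.
\<close>

inductive plan :: "'a rel \<Rightarrow> 'a \<Rightarrow> 'a set \<Rightarrow> ('a \<Rightarrow> nat) \<Rightarrow> nat \<Rightarrow> 'a \<Rightarrow> nat \<Rightarrow> bool"
  for R s S w where
  start: "u \<in> S \<Longrightarrow> (u, s) \<in> R ^^ l \<Longrightarrow> plan R s S w (w u) s l"
| step: "plan R s S w c v x \<Longrightarrow> (v, v') \<in> R \<Longrightarrow> u \<in> S \<Longrightarrow> (u, v') \<in> R ^^ l \<Longrightarrow>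
    plan R s S w (c + w u) v' (x + l)"

text \<open>Parallel lists of tokens, walk vertices and walk lengths record the derivation.
  Repetitions are excluded only later, by weight and by length.\<close>

lemma plan_imp_lists:
  assumes "plan R s S w c v x"
  shows "\<exists>us ps ds. length us = length ps \<and> length ds = length ps \<and> ps \<noteq> [] \<and> hd ps = s \<and>
    last ps = v \<and> set (vwalk_arcs ps) \<subseteq> R \<and> set us \<subseteq> S \<and> c = sum_list (map w us) \<and>
    x = sum_list ds \<and> (\<forall>i<length ps. (us ! i, ps ! i) \<in> R ^^ (ds ! i))"
  using assms
proof induction
  case (start u l)
  then show ?case
    by (intro exI[of _ "[u]"] exI[of _ "[s]"] exI[of _ "[l]"]) auto
next
  case (step c v x v' u l)
  then obtain us ps ds where
    "length us = length ps" "length ds = length ps" "ps \<noteq> []" "hd ps = s"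
    "last ps = v" "set (vwalk_arcs ps) \<subseteq> R" "set us \<subseteq> S" "c = sum_list (map w us)"
    "x = sum_list ds" "\<forall>i<length ps. (us ! i, ps ! i) \<in> R ^^ (ds ! i)"
    by blast
  with step.hyps show ?case
    by (intro exI[of _ "us @ [u]"] exI[of _ "ps @ [v']"] exI[of _ "ds @ [l]"])
      (auto simp: set_vwalk_arcs_snoc nth_append less_Suc_eq)
qed

lemma plan_of_list:
  assumes "p \<noteq> []" "hd p = s" "set (vwalk_arcs p) \<subseteq> R"
    "\<forall>v\<in>set p. \<psi> v \<in> S \<and> (\<psi> v, v) \<in> R ^^ e v"
  shows "plan R s S w (\<Sum>v\<leftarrow>p. w (\<psi> v)) (last p) (\<Sum>v\<leftarrow>p. e v)"
  using assms
proof (induction p rule: rev_nonempty_induct)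
  case (single v)
  then show ?case using plan.start[where u = "\<psi> v" and l = "e v"] by simp
next
  case (snoc v p)
  then have "plan R s S w (\<Sum>v\<leftarrow>p. w (\<psi> v)) (last p) (\<Sum>v\<leftarrow>p. e v)"
    by (auto simp: set_vwalk_arcs_snoc)
  moreover have "(last p, v) \<in> R" using snoc by (simp add: set_vwalk_arcs_snoc)
  ultimately show ?case using plan.step[where v' = v and u = "\<psi> v" and l = "e v"] snoc.prems
    by simp
qed

section \<open>Walks with as many vertices as a shortest path\<close>

text \<open>Each closed detour that is cut out makes the list strictly shorter, so equal length
  means that nothing was cut.\<close>

lemma vwalk_to_vpath_length:
  "length (vwalk_to_vpath p) \<le> length p"
  "length (vwalk_to_vpath p) = length p \<Longrightarrow> distinct p"
proof -
  have "length (vwalk_to_vpath p) \<le> length p \<and> (length (vwalk_to_vpath p) = length p \<longrightarrow> distinct p)"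
  proof (induction p rule: vwalk_to_vpath_induct3)
    case (in_set x xs)
    then show ?case using length_dropWhile_le[of "\<lambda>y. y \<noteq> x" xs] by simp
  qed auto
  then show "length (vwalk_to_vpath p) \<le> length p"
    "length (vwalk_to_vpath p) = length p \<Longrightarrow> distinct p" by auto
qed

text \<open>Shortcutting \<open>q\<close> gives a path, which cannot be shorter than
  \<open>p\<close>. As \<open>q\<close> has the length of \<open>p\<close>, nothing was cut and
  \<open>q\<close> itself is a path.\<close>

lemma shortest_st_pathI:
  assumes p: "shortest_st_path G s t p"
    and q: "vwalk q (with_proj G)" "hd q = s" "last q = t" "length q = length p"
  shows "shortest_st_path G s t q"
proof -
  let ?q = "vwalk_to_vpath q"
  have "st_path G s t ?q"
    using q vwalk_to_vpath_vpath[OF q(1)]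
    by (simp add: st_path_def vwalk_to_vpath_hd vwalk_to_vpath_last)
  then have "length p - 1 \<le> length ?q - 1" using p by (simp add: shortest_st_path_def)
  moreover have "?q \<noteq> []" using q vwalk_to_vpath_nonempty by blast
  moreover have "p \<noteq> []" using q by auto
  ultimately have "length ?q = length q"
    using vwalk_to_vpath_length(1)[of q] q(4) by (cases p; cases ?q; simp)
  then have "distinct q" by (rule vwalk_to_vpath_length(2))
  then have "st_path G s t q" using q by (auto simp: st_path_def)
  then show ?thesis using p q(4) by (simp add: shortest_st_path_def)
qed

text \<open>The intermediate statement is a cheap matching of the tokens to a shortest path. Listing
  the matched tokens in path order gives a plan. Conversely, the prescribed weight makes the tokens
  of a plan enumerate \<open>S\<close>, so its walk has the length of a shortest path.\<close>

lemma spd_yes_iff_plan: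
  assumes inst: "spd_instance I" and r: "bij_betw r (start I) {..<k}"
  defines "w \<equiv> \<lambda>u. 2 ^ k + 2 ^ r u"
  shows "spd_yes I \<longleftrightarrow>
    (\<exists>x\<le>budget I. plan (parcs (graph_of I)) (source I) (start I) w (sum w (start I)) (target I) x)"
proof -
  define G where "G = graph_of I"
  define S where "S = start I"
  define s where "s = source I"
  define t where "t = target I"
  note [simp] = G_def[symmetric] S_def[symmetric] s_def[symmetric] t_def[symmetric]
  interpret pair_graph G using inst by (simp add: spd_instance_def)
  have sym: "sym (parcs G)" using pair_sym_arcs by (simp add: symmetric_def)
  have sub: "parcs G \<subseteq> pverts G \<times> pverts G" using wellformed' by auto
  from inst obtain p0 where p0: "shortest_st_path G s t p0" "card S = length p0"
    and V: "S \<subseteq> pverts G" "s \<in> pverts G" by (auto simp: spd_instance_def)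
  have fin: "finite S" and card: "card S = k"
    using r bij_betw_finite bij_betw_same_card by fastforce+
  have "spd_yes I \<longleftrightarrow> (\<exists>p \<phi> d. shortest_st_path G s t p \<and> bij_betw \<phi> S (set p) \<and>
    (\<forall>u\<in>S. (u, \<phi> u) \<in> parcs G ^^ d u) \<and> sum d S \<le> budget I)"
    (is "_ \<longleftrightarrow> ?M")
  proof
    assume "spd_yes I"
    then obtain C l p where C: "discovery_sequence G C l" "C 0 = S" "l \<le> budget I"
      "shortest_st_path G s t p" "C l = set p" by (auto simp: spd_yes_def)
    show ?M using discovery_sequence_imp_matching[OF sym fin C(1,2)] C(3-) by fastforce
  next
    assume ?M
    then obtain p \<phi> d where M: "shortest_st_path G s t p" "bij_betw \<phi> S (set p)"
      "\<forall>u\<in>S. (u, \<phi> u) \<in> parcs G ^^ d u" "sum d S \<le> budget I" by blast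
    from matching_imp_discovery_sequence[OF sym sub fin V(1) M(2,3)] M(1,4) show "spd_yes I"
      unfolding spd_yes_def by (simp; meson le_trans)
  qed
  also have "?M \<longleftrightarrow> (\<exists>x\<le>budget I. plan (parcs G) s S w (sum w S) t x)"
  proof
    assume ?M
    then obtain p \<phi> d where M: "shortest_st_path G s t p" "bij_betw \<phi> S (set p)"
      "\<forall>u\<in>S. (u, \<phi> u) \<in> parcs G ^^ d u" "sum d S \<le> budget I" by blast
    from M(1) have p: "p \<noteq> []" "hd p = s" "last p = t" "set (vwalk_arcs p) \<subseteq> parcs G" "distinct p"
      by (auto simp: shortest_st_path_def st_path_def vpath_def vwalk_def)
    define \<psi> where "\<psi> = inv_into S \<phi>"
    have \<psi>: "bij_betw \<psi> (set p) S"
      using M(2) by (simp add: \<psi>_def bij_betw_inv_into)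
    have right: "\<phi> (\<psi> v) = v" if "v \<in> set p" for v
      using M(2) that by (simp add: \<psi>_def bij_betw_inv_into_right)
    have \<psi>S: "\<psi> v \<in> S" if "v \<in> set p" for v
      using \<psi> that by (auto simp: bij_betw_def)
    have "\<forall>v\<in>set p. \<psi> v \<in> S \<and> (\<psi> v, v) \<in> parcs G ^^ d (\<psi> v)"
      using M(3) right \<psi>S by metis
    from plan_of_list[OF p(1,2,4) this, of w] p(3,5)
    have "plan (parcs G) s S w (\<Sum>v\<in>set p. w (\<psi> v)) t (\<Sum>v\<in>set p. d (\<psi> v))"
      by (simp add: sum_list_distinct_conv_sum_set)
    then show "\<exists>x\<le>budget I. plan (parcs G) s S w (sum w S) t x"
      using M(4) by (auto simp: sum.reindex_bij_betw[OF \<psi>])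
  next
    assume "\<exists>x\<le>budget I. plan (parcs G) s S w (sum w S) t x"
    then obtain x where x: "x \<le> budget I" "plan (parcs G) s S w (sum w S) t x" by blast
    from plan_imp_lists[OF x(2)] obtain us ps ds where
      L: "length us = length ps" "length ds = length ps" "ps \<noteq> []" "hd ps = s"
      "last ps = t" "set (vwalk_arcs ps) \<subseteq> parcs G" "set us \<subseteq> S" "sum w S = sum_list (map w us)"
      "x = sum_list ds" "\<forall>i<length ps. (us ! i, ps ! i) \<in> parcs G ^^ (ds ! i)"
      by blast
    have us: "distinct us" "set us = S"
      using weight_unique[OF r, of us] L(7,8) by (auto simp: w_def)
    then have len: "length ps = length p0"
      using p0(2) L(1) distinct_card[OF us(1)] by simp
    have "set ps \<subseteq> pverts G"
      using L(3,4,6) V(2)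
    proof (induction ps rule: rev_nonempty_induct)
      case (snoc v ps)
      then show ?case using sub by (auto simp: set_vwalk_arcs_snoc)
    qed simp
    then have "vwalk ps (with_proj G)" using L(3,6) by (simp add: vwalk_def)
    from shortest_st_pathI[OF p0(1) this L(4,5) len] have ps: "shortest_st_path G s t ps" .
    then have dist: "distinct ps" by (auto simp: shortest_st_path_def st_path_def vpath_def)
    define ix where "ix = inv_into {..<length us} ((!) us)"
    have bij: "bij_betw ((!) us) {..<length us} S"
      using bij_betw_nth[OF us(1) refl us(2)[symmetric]] .
    have ix: "bij_betw ix S {..<length us}" unfolding ix_def using bij by (rule bij_betw_inv_into)
    have ix_nth: "us ! ix u = u" if "u \<in> S" for u
      using bij that by (simp add: ix_def bij_betw_inv_into_right)
    have "bij_betw ((!) ps) {..<length us} (set ps)"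
      using bij_betw_nth[OF dist] L(1) by simp
    from bij_betw_trans[OF ix this] have \<phi>: "bij_betw ((!) ps \<circ> ix) S (set ps)" .
    have "(u, ((!) ps \<circ> ix) u) \<in> parcs G ^^ ((!) ds \<circ> ix) u" if "u \<in> S" for u
    proof -
      have "ix u < length ps" using ix that L(1) by (auto simp: bij_betw_def)
      then show ?thesis using L(10) ix_nth[OF that] by auto
    qed
    moreover have "sum ((!) ds \<circ> ix) S = x"
      using sum.reindex_bij_betw[OF ix, of "(!) ds"] L(1,2,9)
      by (simp add: sum_list_sum_nth atLeast0LessThan)
    ultimately show ?M using ps \<phi> x(1) by blast
  qed
  finally show ?thesis by simp
qed

section \<open>Timed execution\<close>

text \<open>Total correctness with an upper bound on the time, whereas \<open>exec\<close> counts
  exactly; a bound lets branches of different length be joined.\<close>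

definition runs :: "prog \<Rightarrow> state \<Rightarrow> nat \<Rightarrow> (state \<Rightarrow> bool) \<Rightarrow> bool" where
  "runs c \<sigma> T Q \<longleftrightarrow> (\<exists>t \<tau>. exec c \<sigma> t \<tau> \<and> t \<le> T \<and> Q \<tau>)"

definition setreg :: "nat \<Rightarrow> nat \<Rightarrow> state \<Rightarrow> state" where
  "setreg x a \<sigma> = \<sigma>\<lparr>reg := (reg \<sigma>)(x := a)\<rparr>"

definition setcell :: "nat \<Rightarrow> nat \<Rightarrow> nat \<Rightarrow> state \<Rightarrow> state" where
  "setcell a i b \<sigma> = \<sigma>\<lparr>arr := (arr \<sigma>)(a := (arr \<sigma> a)(i := b))\<rparr>"

lemma reg_setreg [simp]: "reg (setreg x a \<sigma>) y = (if y = x then a else reg \<sigma> y)"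
  and arr_setreg [simp]: "arr (setreg x a \<sigma>) = arr \<sigma>"
  and reg_setcell [simp]: "reg (setcell a' i b \<sigma>) = reg \<sigma>"
  and arr_setcell [simp]:
    "arr (setcell a' i b \<sigma>) c = (if c = a' then (arr \<sigma> a')(i := b) else arr \<sigma> c)"
  by (auto simp: setreg_def setcell_def)

lemma runs_mono: "runs c \<sigma> T Q \<Longrightarrow> T \<le> T' \<Longrightarrow> (\<And>\<tau>. Q \<tau> \<Longrightarrow> Q' \<tau>) \<Longrightarrow> runs c \<sigma> T' Q'"
  unfolding runs_def by (meson le_trans)

lemma runs_Skip: "Q \<sigma> \<Longrightarrow> 1 \<le> T \<Longrightarrow> runs Skip \<sigma> T Q"
  unfolding runs_def using exec.Skip by blast

lemma runs_Assign: "Q (setreg x (val \<sigma> e) \<sigma>) \<Longrightarrow> 1 + cost e \<le> T \<Longrightarrow> runs (Assign x e) \<sigma> T Q"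
  unfolding runs_def setreg_def using exec.Assign by blast

lemma runs_Store:
  "Q (setcell a (val \<sigma> d) (val \<sigma> e) \<sigma>) \<Longrightarrow> 1 + cost d + cost e \<le> T \<Longrightarrow> runs (Store a d e) \<sigma> T Q"
  unfolding runs_def setcell_def using exec.Store by blast

text \<open>The postcondition of the first program is itself a run of the second, so straight-line
  code can be executed symbolically without naming intermediate assertions.\<close>

lemma runs_Seq:
  "runs c \<sigma> T (\<lambda>\<tau>. runs d \<tau> U Q) \<Longrightarrow> T + U \<le> V \<Longrightarrow> runs (Seq c d) \<sigma> V Q"
  unfolding runs_def by (meson add_mono exec.Seq le_trans)

lemma runs_SeqI:
  "runs c \<sigma> T P \<Longrightarrow> (\<And>\<tau>. P \<tau> \<Longrightarrow> runs d \<tau> U Q) \<Longrightarrow> runs (Seq c d) \<sigma> (T + U) Q"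
  by (rule runs_Seq[where T = T and U = U], erule runs_mono) auto

lemma runs_Cond:
  assumes "val \<sigma> e \<noteq> 0 \<Longrightarrow> runs c \<sigma> T Q" "val \<sigma> e = 0 \<Longrightarrow> runs d \<sigma> T Q" "1 + cost e + T \<le> U"
  shows "runs (Cond e c d) \<sigma> U Q"
proof (cases "val \<sigma> e = 0")
  case True
  then obtain t \<tau> where "exec d \<sigma> t \<tau>" "t \<le> T" "Q \<tau>" using assms(2) by (auto simp: runs_def)
  then show ?thesis
    using exec.CondFalse[OF True, of d t \<tau> c] assms(3) unfolding runs_def
    by (meson add_left_mono le_trans)
next
  case False
  then obtain t \<tau> where "exec c \<sigma> t \<tau>" "t \<le> T" "Q \<tau>" using assms(1) by (auto simp: runs_def)
  then show ?thesis
    using exec.CondTrue[OF False, of c t \<tau> d] assms(3) unfolding runs_def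
    by (meson add_left_mono le_trans)
qed

text \<open>The loop runs for register \<open>x\<close> from 0 up to the content of register \<open>y\<close>, exclusively.\<close>

definition For :: "nat \<Rightarrow> nat \<Rightarrow> prog \<Rightarrow> prog" where
  "For x y c = Seq (Assign x (Const 0))
     (While (Sub (Reg y) (Reg x)) (Seq c (Assign x (Add (Reg x) (Const 1)))))"

text \<open>\<open>I i\<close> is to hold once the counter equals \<open>i\<close>. The 8 steps per
  iteration pay for guard and increment, 4 each; the final 6 are the initial assignment (2) and the
  failing guard (4).\<close>

lemma runs_For:
  assumes init: "I 0 (setreg x 0 \<sigma>)"
    and regs: "\<And>i \<tau>. i \<le> m \<Longrightarrow> I i \<tau> \<Longrightarrow> reg \<tau> x = i \<and> reg \<tau> y = m"
    and body: "\<And>i \<tau>. i < m \<Longrightarrow> I i \<tau> \<Longrightarrow>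
      runs c \<tau> T (\<lambda>\<tau>'. reg \<tau>' x = i \<and> I (Suc i) (setreg x (Suc i) \<tau>'))"
    and post: "\<And>\<tau>. I m \<tau> \<Longrightarrow> Q \<tau>"
    and time: "m * (T + 8) + 6 \<le> U"
  shows "runs (For x y c) \<sigma> U Q"
proof -
  let ?W = "While (Sub (Reg y) (Reg x)) (Seq c (Assign x (Add (Reg x) (Const 1))))"
  have loop: "runs ?W \<tau> (j * (T + 8) + 4) Q" if "I i \<tau>" "i + j = m" for i j \<tau>
    using that
  proof (induction j arbitrary: i \<tau>)
    case 0
    then have "val \<tau> (Sub (Reg y) (Reg x)) = 0" using regs[of i \<tau>] by simp
    from exec.WhileFalse[OF this] show ?case using 0 post by (force simp: runs_def)
  next
    case (Suc j)
    then have ne: "val \<tau> (Sub (Reg y) (Reg x)) \<noteq> 0" using regs[of i \<tau>] by simp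
    from body[of i \<tau>] Suc.prems obtain t \<tau>' where c: "exec c \<tau> t \<tau>'" "t \<le> T" "reg \<tau>' x = i"
      "I (Suc i) (setreg x (Suc i) \<tau>')" by (auto simp: runs_def)
    have "exec (Assign x (Add (Reg x) (Const 1))) \<tau>' 4 (setreg x (Suc i) \<tau>')"
      using exec.Assign[of x "Add (Reg x) (Const 1)" \<tau>'] c(3)
      by (simp add: setreg_def eval_nat_numeral)
    note b = exec.Seq[OF c(1) this]
    from Suc.IH[OF c(4)] Suc.prems obtain t' \<tau>'' where
      w: "exec ?W (setreg x (Suc i) \<tau>') t' \<tau>''" "t' \<le> j * (T + 8) + 4" "Q \<tau>''"
      by (auto simp: runs_def)
    from exec.WhileTrue[OF ne b w(1)] w(2,3) c(2) show ?case
      by (force simp: runs_def)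
  qed
  have "runs (Assign x (Const 0)) \<sigma> 2 (\<lambda>\<tau>. runs ?W \<tau> (m * (T + 8) + 4) Q)"
    using loop[OF init] by (intro runs_Assign) simp_all
  then show ?thesis
    unfolding For_def by (rule runs_Seq) (use time in simp)
qed

definition same :: "nat set \<Rightarrow> nat set \<Rightarrow> state \<Rightarrow> state \<Rightarrow> bool" where
  "same X A \<sigma> \<tau> \<longleftrightarrow> (\<forall>x. x \<notin> X \<longrightarrow> reg \<tau> x = reg \<sigma> x) \<and> (\<forall>a. a \<notin> A \<longrightarrow> arr \<tau> a = arr \<sigma> a)"

lemma same_refl [simp]: "same X A \<sigma> \<sigma>"
  by (simp add: same_def)

lemma same_setreg [simp]: "x \<in> X \<Longrightarrow> same X A \<sigma> (setreg x a \<tau>) = same X A \<sigma> \<tau>"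
  by (auto simp: same_def)

lemma same_setcell [simp]: "a \<in> A \<Longrightarrow> same X A \<sigma> (setcell a i b \<tau>) = same X A \<sigma> \<tau>"
  by (auto simp: same_def)

lemma same_reg: "same X A \<sigma> \<tau> \<Longrightarrow> x \<notin> X \<Longrightarrow> reg \<tau> x = reg \<sigma> x"
  and same_arr: "same X A \<sigma> \<tau> \<Longrightarrow> a \<notin> A \<Longrightarrow> arr \<tau> a = arr \<sigma> a"
  by (simp_all add: same_def)

section \<open>Relaxation of tables stored row by row\<close>

text \<open>Row and column are quotient and remainder by \<open>n\<close>. Hence an update of one
  table entry leaves all others alone.\<close>

lemma grid_eq_iff:
  fixes n :: nat
  assumes "v < n" "v' < n"
  shows "u * n + v = u' * n + v' \<longleftrightarrow> u = u' \<and> v = v'"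
proof
  assume eq: "u * n + v = u' * n + v'"
  have "(u * n + v) div n = (u' * n + v') div n" "(u * n + v) mod n = (u' * n + v') mod n"
    using eq by auto
  then show "u = u' \<and> v = v'" using assms by simp
qed simp

text \<open>
  \<open>sweep a d e x\<close> replaces the entry \<open>(d, v)\<close> of the table in array \<open>a\<close> by its maximum with
  \<open>(e, w) - x\<close>, for all \<open>u\<close>, \<open>v\<close> and all neighbours \<open>w\<close> of \<open>v\<close>; the expressions \<open>d\<close>, \<open>e\<close> and \<open>x\<close> may
  refer to \<open>u\<close> and \<open>v\<close> by registers 10 and 11. Array 1 is assumed to hold the multiples of \<open>n\<close>.
\<close>

definition sweep :: "nat \<Rightarrow> expr \<Rightarrow> expr \<Rightarrow> expr \<Rightarrow> prog" where
  "sweep a d e x = For 10 1 (For 11 1 (For 12 1 (Cond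
     (Cell 0 (Add (Const 1) (Add (Cell 1 (Reg 12)) (Reg 11))))
     (Store a (Add (Cell 1 d) (Reg 11))
       (Add (Cell a (Add (Cell 1 d) (Reg 11)))
         (Sub (Sub (Cell a (Add (Cell 1 e) (Reg 12))) x) (Cell a (Add (Cell 1 d) (Reg 11))))))
     Skip)))"

text \<open>The table is updated in place, so a read may already see new values. This is harmless:
  \<open>P\<close> is closed under single relaxations, and since entries only grow, every lower
  bound in terms of the old table survives.\<close>

lemma runs_sweep:
  assumes reg1: "reg \<sigma> 1 = n" and n: "0 < n" and a: "a \<noteq> 0" "a \<noteq> 1"
    and adj: "\<And>u v. u < n \<Longrightarrow> v < n \<Longrightarrow> arr \<sigma> 0 (1 + (u * n + v)) = of_bool ((u, v) \<in> R)"
    and M: "\<And>i. i < m \<Longrightarrow> arr \<sigma> 1 i = i * n" and nm: "n \<le> m"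
    and d: "\<And>\<tau> u. same {10, 11, 12} {a} \<sigma> \<tau> \<Longrightarrow> u < n \<Longrightarrow> reg \<tau> 10 = u \<Longrightarrow> val \<tau> d = dr u"
    and e: "\<And>\<tau> u. same {10, 11, 12} {a} \<sigma> \<tau> \<Longrightarrow> u < n \<Longrightarrow> reg \<tau> 10 = u \<Longrightarrow> val \<tau> e = er u"
    and x: "\<And>\<tau> u v. same {10, 11, 12} {a} \<sigma> \<tau> \<Longrightarrow> u < n \<Longrightarrow> v < n \<Longrightarrow> reg \<tau> 10 = u \<Longrightarrow> reg \<tau> 11 = v
      \<Longrightarrow> val \<tau> x = cs u v"
    and rows: "\<And>u. u < n \<Longrightarrow> dr u < m" "\<And>u. u < n \<Longrightarrow> er u < m"
    and costs: "cost d \<le> 8" "cost e \<le> 8" "cost x \<le> 16"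
    and P: "P (arr \<sigma> a)"
    and step: "\<And>T u v w. P T \<Longrightarrow> u < n \<Longrightarrow> v < n \<Longrightarrow> w < n \<Longrightarrow> (w, v) \<in> R \<Longrightarrow>
      P (T(dr u * n + v := max (T (dr u * n + v)) (T (er u * n + w) - cs u v)))"
  shows "runs (sweep a d e x) \<sigma> (142 * n ^ 3) (\<lambda>\<tau>. same {10, 11, 12} {a} \<sigma> \<tau> \<and> P (arr \<tau> a) \<and>
    (\<forall>i. arr \<sigma> a i \<le> arr \<tau> a i) \<and>
    (\<forall>u v w. u < n \<longrightarrow> v < n \<longrightarrow> w < n \<longrightarrow> (w, v) \<in> R \<longrightarrow>
      arr \<sigma> a (er u * n + w) - cs u v \<le> arr \<tau> a (dr u * n + v)))"
proof -
  \<comment> \<open>\<open>D\<close> marks the triples already relaxed; \<open>?A u v w\<close>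
    below selects those lexicographically before \<open>(u, v, w)\<close>, in accordance with the
    nesting of the loops.\<close>
  define J where "J D \<tau> \<longleftrightarrow> same {10, 11, 12} {a} \<sigma> \<tau> \<and> P (arr \<tau> a) \<and>
    (\<forall>i. arr \<sigma> a i \<le> arr \<tau> a i) \<and>
    (\<forall>u v w. D u v w \<longrightarrow> u < n \<longrightarrow> v < n \<longrightarrow> w < n \<longrightarrow> (w, v) \<in> R \<longrightarrow>
      arr \<sigma> a (er u * n + w) - cs u v \<le> arr \<tau> a (dr u * n + v))"
    for D :: "nat \<Rightarrow> nat \<Rightarrow> nat \<Rightarrow> bool" and \<tau>
  have J_setreg [simp]: "J D (setreg y b \<tau>) = J D \<tau>" if "y \<in> {10, 11, 12}" for D y b \<tau>
    using that by (simp add: J_def)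
  have J_mono: "J D' \<tau>" if "J D \<tau>" "\<And>u v w. D' u v w \<Longrightarrow> u < n \<Longrightarrow> v < n \<Longrightarrow> w < n \<Longrightarrow> D u v w" for D D' \<tau>
    using that unfolding J_def by blast
  have J_reg1: "reg \<tau> (Suc 0) = n" if "J D \<tau>" for D \<tau>
    using that same_reg[of "{10, 11, 12}" "{a}" \<sigma> \<tau> 1] reg1 by (simp add: J_def)
  let ?d = "Add (Cell 1 d) (Reg 11)"
  let ?s = "Sub (Cell a (Add (Cell 1 e) (Reg 12))) x"
  let ?A = "\<lambda>u v w u' v' w'. u' < u \<or> u' = u \<and> (v' < v \<or> v' = v \<and> w' < (w :: nat))"
  have body: "runs (Cond (Cell 0 (Add (Const 1) (Add (Cell 1 (Reg 12)) (Reg 11))))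
      (Store a ?d (Add (Cell a ?d) (Sub ?s (Cell a ?d)))) Skip) \<tau> 100
      (\<lambda>\<tau>'. J (?A u v (Suc w)) \<tau>' \<and> reg \<tau>' 10 = u \<and> reg \<tau>' 11 = v \<and> reg \<tau>' 12 = w)"
    if J: "J (?A u v w) \<tau>" and r: "reg \<tau> 10 = u" "reg \<tau> 11 = v" "reg \<tau> 12 = w"
      and uvw: "u < n" "v < n" "w < n" for u v w \<tau>
  proof -
    have same: "same {10, 11, 12} {a} \<sigma> \<tau>" using J by (simp add: J_def)
    have arr0: "arr \<tau> 0 = arr \<sigma> 0" and arr1: "arr \<tau> (Suc 0) = arr \<sigma> 1"
      using same a by (auto simp: same_def)
    have adj': "val \<tau> (Cell 0 (Add (Const 1) (Add (Cell 1 (Reg 12)) (Reg 11)))) = of_bool ((w, v) \<in> R)"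
      using adj[of w v] uvw nm M[of w] r by (simp add: arr0 arr1)
    let ?i = "dr u * n + v"
    let ?T = "arr \<tau> a"
    have vd: "val \<tau> ?d = ?i"
      using d[OF same uvw(1) r(1)] r M[OF rows(1)[OF uvw(1)]] by (simp add: arr1)
    have vs: "val \<tau> ?s = ?T (er u * n + w) - cs u v"
      using e[OF same uvw(1) r(1)] x[OF same uvw(1,2) r(1,2)] r M[OF rows(2)[OF uvw(1)]]
      by (simp add: arr1)
    have vm: "val \<tau> (Add (Cell a ?d) (Sub ?s (Cell a ?d))) = max (?T ?i) (?T (er u * n + w) - cs u v)"
      using vd vs by (simp add: max_def) arith
    have done1: "J (?A u v (Suc w)) (setcell a ?i (max (?T ?i) (?T (er u * n + w) - cs u v)) \<tau>)"
      if "(w, v) \<in> R"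
    proof -
      have ge: "arr \<sigma> a i \<le> (?T(?i := max (?T ?i) (?T (er u * n + w) - cs u v))) i" for i
        using J by (auto simp: J_def max_def intro: le_trans)
      have up: "?T i \<le> (?T(?i := max (?T ?i) (?T (er u * n + w) - cs u v))) i" for i
        by auto
      have "arr \<sigma> a (er u' * n + w') - cs u' v'
          \<le> (?T(?i := max (?T ?i) (?T (er u * n + w) - cs u v))) (dr u' * n + v')"
        if "?A u v (Suc w) u' v' w'" "u' < n" "v' < n" "w' < n" "(w', v') \<in> R" for u' v' w'
      proof (cases "u' = u \<and> v' = v \<and> w' = w")
        case True
        have "arr \<sigma> a (er u * n + w) \<le> ?T (er u * n + w)" using J by (simp add: J_def)
        then show ?thesis using True by (simp add: max_def) (meson diff_le_mono le_trans nat_le_linear)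
      next
        case False
        then have "?A u v w u' v' w'" using that(1) by auto
        then have "arr \<sigma> a (er u' * n + w') - cs u' v' \<le> ?T (dr u' * n + v')"
          using J that(2-) unfolding J_def by blast
        then show ?thesis using up le_trans by blast
      qed
      then show ?thesis
        using J step[of ?T u v w] uvw that ge by (simp add: J_def)
    qed
    have done2: "J (?A u v (Suc w)) \<tau>" if "(w, v) \<notin> R"
    proof -
      have "arr \<sigma> a (er u' * n + w') - cs u' v' \<le> arr \<tau> a (dr u' * n + v')"
        if "?A u v (Suc w) u' v' w'" "u' < n" "v' < n" "w' < n" "(w', v') \<in> R" for u' v' w'
      proof -
        have "?A u v w u' v' w'" using that \<open>(w, v) \<notin> R\<close> by (auto simp: less_Suc_eq)
        then show ?thesis using J that(2-) unfolding J_def by blast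
      qed
      then show ?thesis using J by (simp add: J_def)
    qed
    show ?thesis
      apply (rule runs_Cond[where T = 80])
        apply (rule runs_Store)
         apply (unfold vd vm)
      using adj' done1 r apply (auto split: if_splits)[1]
      using costs apply simp
       apply (rule runs_Skip)
      using adj' done2 r apply (auto split: if_splits)[1]
       apply simp
      apply simp
      done
  qed
  \<comment> \<open>A loop adds 8 steps per iteration and 6 once. As \<open>n\<close> is positive,
    each level raises the leading coefficient by at most 14: from 100 to 114, 128 and 142.\<close>
  have inner: "runs (For 12 1 (Cond (Cell 0 (Add (Const 1) (Add (Cell 1 (Reg 12)) (Reg 11))))
      (Store a ?d (Add (Cell a ?d) (Sub ?s (Cell a ?d)))) Skip)) \<tau> (114 * n)
      (\<lambda>\<tau>'. J (?A u (Suc v) 0) \<tau>' \<and> reg \<tau>' 10 = u \<and> reg \<tau>' 11 = v)"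
    if "J (?A u v 0) \<tau>" "reg \<tau> 10 = u" "reg \<tau> 11 = v" "u < n" "v < n" for u v \<tau>
    apply (rule runs_For[where m = n and T = 100 and
        I = "\<lambda>w \<tau>. J (?A u v w) \<tau> \<and> reg \<tau> 10 = u \<and> reg \<tau> 11 = v \<and> reg \<tau> 12 = w"])
    using that apply simp
    using J_reg1 apply (simp, blast)
    subgoal for w \<tau>
      apply (rule runs_mono[OF body[of u v w]])
      using that by simp_all
    subgoal by (auto elim!: J_mono simp: less_Suc_eq)
    using n by simp
  have mid: "runs (For 11 1 (For 12 1 (Cond (Cell 0 (Add (Const 1) (Add (Cell 1 (Reg 12)) (Reg 11))))
      (Store a ?d (Add (Cell a ?d) (Sub ?s (Cell a ?d)))) Skip))) \<tau> (128 * n ^ 2)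
      (\<lambda>\<tau>'. J (?A (Suc u) 0 0) \<tau>' \<and> reg \<tau>' 10 = u)"
    if "J (?A u 0 0) \<tau>" "reg \<tau> 10 = u" "u < n" for u \<tau>
    apply (rule runs_For[where m = n and T = "114 * n" and
        I = "\<lambda>v \<tau>. J (?A u v 0) \<tau> \<and> reg \<tau> 10 = u \<and> reg \<tau> 11 = v"])
    using that apply simp
    using J_reg1 apply (simp, blast)
    subgoal for w \<tau>
      apply (rule runs_mono[OF inner[of u w]])
      using that by simp_all
    subgoal by (auto elim!: J_mono simp: less_Suc_eq)
    using n by (simp add: power2_eq_square algebra_simps) (cases n; simp)
  show ?thesis
    unfolding sweep_def
    apply (rule runs_For[where m = n and T = "128 * n ^ 2" and
        I = "\<lambda>u \<tau>. J (?A u 0 0) \<tau> \<and> reg \<tau> 10 = u"])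
    using P apply (simp add: J_def)
    subgoal for i \<tau> using J_reg1[of "?A i 0 0" \<tau>] by simp
    subgoal for w \<tau>
      apply (rule runs_mono[OF mid[of w]])
      by simp_all
    subgoal by (simp add: J_def)
    using n by (simp add: power2_eq_square power3_eq_cube algebra_simps)
      (cases n; simp add: algebra_simps)
qed

section \<open>The program\<close>

text \<open>
  Register 0 holds the length of the input, registers 1--5 hold \<open>n\<close>, \<open>s\<close>, \<open>t\<close>, \<open>b + 1\<close> and the
  offset of the token vector, register 6 holds \<open>2\<^sup>k\<close>, register 7 the next power of 2 to be handed
  out, register 8 the total weight \<open>W\<close> and register 9 the number of rows of the tables; the others
  are counters. Array 1 holds the multiples of \<open>n\<close>, array 2 the weights, array 3 the distances
  from the tokens and array 4 the costs of partial plans. In arrays 3 and 4, a cost \<open>x\<close> is stored as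
  its slack \<open>b + 1 - x\<close>, so that the initial value 0 stands for a cost exceeding the budget. The
  maximum of \<open>x\<close> and \<open>y\<close> is computed as \<open>x + (y - x)\<close>. Row 0 of array 4 is constantly 0, which makes
  the row \<open>c - w\<close> harmless if the subtraction truncates. Vertices without a token have weight 0 in
  array 2, but their slack 0 in array 3 keeps them from being used.
\<close>

definition setup_prog :: prog where
  "setup_prog =
    Seq (Assign 1 (Cell 0 (Const 0)))
    (Seq (Assign 2 (Cell 0 (Sub (Sub (Reg 0) (Reg 1)) (Const 3))))
    (Seq (Assign 3 (Cell 0 (Sub (Sub (Reg 0) (Reg 1)) (Const 2))))
    (Seq (Assign 4 (Add (Cell 0 (Sub (Reg 0) (Const 1))) (Const 1)))
    (Seq (Assign 5 (Sub (Sub (Reg 0) (Reg 1)) (Const 1)))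
    (Seq (Assign 6 (Const 1)) (Assign 7 (Const 1)))))))"

text \<open>Every weight contains 2^k, so the tokens are counted in a separate pass before any
  weight is stored.\<close>

definition power_prog :: prog where
  "power_prog =
    For 11 1 (Cond (Cell 0 (Add (Reg 5) (Reg 11))) (Assign 6 (Add (Reg 6) (Reg 6))) Skip)"

definition weight_prog :: prog where
  "weight_prog =
    For 11 1 (Cond (Cell 0 (Add (Reg 5) (Reg 11)))
      (Seq (Store 2 (Reg 11) (Add (Reg 6) (Reg 7)))
      (Seq (Assign 7 (Add (Reg 7) (Reg 7))) (Assign 8 (Add (Reg 8) (Cell 2 (Reg 11))))))
      Skip)"

text \<open>Repeated addition replaces multiplication: afterwards the offset of a table row is a
  single lookup.\<close>

definition row_prog :: prog where
  "row_prog = For 11 9 (Seq (Store 1 (Reg 11) (Reg 13)) (Assign 13 (Add (Reg 13) (Reg 1))))"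

definition diagonal_prog :: prog where
  "diagonal_prog =
    For 11 1 (Cond (Cell 0 (Add (Reg 5) (Reg 11)))
      (Store 3 (Add (Cell 1 (Reg 11)) (Reg 11)) (Reg 4)) Skip)"

text \<open>Register 0 still holds the input length. It is at least n^2 and thus bounds the number
  of arcs of a shortest walk, so this many sweeps suffice.\<close>

definition dist_prog :: prog where
  "dist_prog = For 14 0 (sweep 3 (Reg 10) (Reg 10) (Const 1))"

definition start_prog :: prog where
  "start_prog =
    For 11 1 (Store 4 (Add (Cell 1 (Cell 2 (Reg 11))) (Reg 2))
      (Cell 3 (Add (Cell 1 (Reg 11)) (Reg 2))))"

text \<open>Weights are treated in increasing order. Since tokens have positive weight, extending a
  plan to weight c uses smaller rows only, and one sweep per row suffices.\<close>

definition plan_prog :: prog where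
  "plan_prog =
    For 14 9 (sweep 4 (Reg 14) (Sub (Reg 14) (Cell 2 (Reg 10)))
      (Sub (Reg 4) (Cell 3 (Add (Cell 1 (Reg 10)) (Reg 11)))))"

definition output_prog :: prog where
  "output_prog = Cond (Cell 4 (Add (Cell 1 (Reg 8)) (Reg 3))) (Assign 0 (Const 1)) (Assign 0 (Const 0))"

definition spd_prog :: prog where
  "spd_prog =
    Seq (Seq (Seq (Seq (Seq (Seq (Seq (Seq (Seq setup_prog power_prog) weight_prog)
      (Assign 9 (Add (Reg 8) (Add (Reg 1) (Const 1))))) row_prog) diagonal_prog) dist_prog)
      start_prog) plan_prog) output_prog"

lemma loop_time:
  assumes "1 \<le> m" "1 \<le> (c :: nat)"
  shows "m * (142 * c + 8) + 6 \<le> 156 * m * c"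
proof -
  have "m * 1 \<le> m * c" "1 * 1 \<le> m * c" using assms by (intro mult_le_mono; simp)+
  then have "142 * (m * c) + 8 * m + 6 \<le> 156 * (m * c)" by linarith
  then show ?thesis by (simp add: algebra_simps)
qed

section \<open>Correctness and running time of the phases\<close>

locale spd_data =
  fixes n s t b L tb :: nat and S :: "nat set" and R :: "nat rel" and inp :: "nat \<Rightarrow> nat"
  assumes n: "0 < n" and s: "s < n" and t: "t < n" and S: "S \<subseteq> {..<n}"
    and R: "R \<subseteq> {..<n} \<times> {..<n}" and L: "n * n \<le> L" and tb: "0 < tb"
    and inp_arc: "\<And>u v. u < n \<Longrightarrow> v < n \<Longrightarrow> inp (1 + (u * n + v)) = of_bool ((u, v) \<in> R)"
    and inp_token: "\<And>v. v < n \<Longrightarrow> inp (tb + v) = of_bool (v \<in> S)"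
begin

definition "rank u = card (S \<inter> {..<u})"
definition "k = card S"
definition "w u = (2 :: nat) ^ k + 2 ^ rank u"
definition "wt u = (if u \<in> S then w u else 0)"
definition "W = sum w S"
text \<open>Array 1 serves both tables, the distances with rows below \<open>n\<close> and the plans
  with rows up to \<open>W\<close>; \<open>B\<close> exceeds all these row numbers.\<close>

definition "B = W + n + 1"

lemma finite_S: "finite S"
  using S finite_subset by blast

lemma bij_rank: "bij_betw rank S {..<k}"
proof -
  have mono: "rank u < rank v" if "u \<in> S" "u < v" for u v
    unfolding rank_def using that by (intro psubset_card_mono) auto
  have "inj_on rank S"
    using mono by (intro inj_onI) (metis less_irrefl nat_neq_iff)
  moreover have "rank u < k" if "u \<in> S" for u
    unfolding rank_def k_def using that finite_S by (intro psubset_card_mono) auto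
  then have "rank ` S \<subseteq> {..<k}" by auto
  ultimately have "rank ` S = {..<k}"
    by (intro card_subset_eq) (auto simp: card_image k_def)
  with \<open>inj_on rank S\<close> show ?thesis by (simp add: bij_betw_def)
qed

lemma w_pos: "0 < w u"
  by (simp add: w_def)

lemma w_le_W: "u \<in> S \<Longrightarrow> w u \<le> W"
  unfolding W_def using finite_S by (intro member_le_sum) auto

lemma wt_less_B: "wt u < B"
  using w_le_W[of u] by (auto simp: wt_def B_def)

lemma rank_Suc: "rank (Suc i) = (if i \<in> S then Suc (rank i) else rank i)"
proof -
  have "S \<inter> {..<Suc i} = (if i \<in> S then insert i (S \<inter> {..<i}) else S \<inter> {..<i})"
    by (auto simp: less_Suc_eq)
  then show ?thesis by (simp add: rank_def)
qed

lemma sum_w_Suc: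
  "sum w (S \<inter> {..<Suc i}) = (if i \<in> S then sum w (S \<inter> {..<i}) + w i else sum w (S \<inter> {..<i}))"
proof -
  have "S \<inter> {..<Suc i} = (if i \<in> S then insert i (S \<inter> {..<i}) else S \<inter> {..<i})"
    by (auto simp: less_Suc_eq)
  then show ?thesis by simp
qed

lemma rank_n: "rank n = k" and S_inter_n: "S \<inter> {..<n} = S"
  using S by (simp_all add: rank_def k_def Int_absorb2)

definition "base \<sigma> \<longleftrightarrow> arr \<sigma> 0 = inp \<and> reg \<sigma> 0 = L \<and> reg \<sigma> 1 = n \<and> reg \<sigma> 2 = s \<and> reg \<sigma> 3 = t \<and>
  reg \<sigma> 4 = Suc b \<and> reg \<sigma> 5 = tb"

lemma base_setreg [simp]: "5 < x \<Longrightarrow> base (setreg x a \<sigma>) = base \<sigma>"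
  by (auto simp: base_def)

lemma base_setcell [simp]: "0 < a \<Longrightarrow> base (setcell a i c \<sigma>) = base \<sigma>"
  by (auto simp: base_def)

lemma runs_token_powers:
  assumes "base \<sigma>" "reg \<sigma> 6 = 1"
  shows "runs power_prog \<sigma> (30 * n) (\<lambda>\<tau>. same {6, 11} {} \<sigma> \<tau> \<and> reg \<tau> 6 = 2 ^ k)"
  unfolding power_prog_def
  apply (rule runs_For[where m = n and T = 10 and
      I = "\<lambda>i \<tau>. same {6, 11} {} \<sigma> \<tau> \<and> base \<tau> \<and> reg \<tau> 11 = i \<and> reg \<tau> 6 = 2 ^ rank i"])
  using assms apply (simp add: rank_def)
    apply (simp add: base_def)
  subgoal for i \<tau>
    apply (rule runs_Cond[where T = 4])
    subgoal apply (rule runs_Assign)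
      using inp_token[of i] by (auto simp: base_def rank_Suc)
    subgoal apply (rule runs_Skip)
      using inp_token[of i] by (auto simp: base_def rank_Suc)
    by simp
  using n by (simp_all add: rank_n)

lemma runs_weights:
  assumes "base \<sigma>" "reg \<sigma> 6 = 2 ^ k" "reg \<sigma> 7 = 1" "reg \<sigma> 8 = 0" "arr \<sigma> 2 = (\<lambda>_. 0)"
  shows "runs weight_prog \<sigma> (40 * n)
    (\<lambda>\<tau>. same {7, 8, 11} {2} \<sigma> \<tau> \<and> reg \<tau> 8 = W \<and> arr \<tau> 2 = wt)"
  unfolding weight_prog_def
  apply (rule runs_For[where m = n and T = 24 and
      I = "\<lambda>i \<tau>. same {7, 8, 11} {2} \<sigma> \<tau> \<and> base \<tau> \<and> reg \<tau> 11 = i \<and> reg \<tau> 6 = 2 ^ k \<and>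
        reg \<tau> 7 = 2 ^ rank i \<and> reg \<tau> 8 = sum w (S \<inter> {..<i}) \<and>
        arr \<tau> 2 = (\<lambda>u. if u < i then wt u else 0)"])
  using assms apply (simp add: rank_def)
    apply (simp add: base_def)
  subgoal for i \<tau>
    apply (rule runs_Cond[where T = 17])
    subgoal
      apply (rule runs_Seq[where T = 5 and U = 12])
       apply (rule runs_Store)
        apply (rule runs_Seq[where T = 4 and U = 8])
         apply (rule runs_Assign)
          apply (rule runs_Assign)
      using inp_token[of i] w_def[of i]
      by (auto simp: base_def rank_Suc sum_w_Suc wt_def fun_eq_iff less_Suc_eq)
    subgoal apply (rule runs_Skip)
      using inp_token[of i] by (auto simp: base_def rank_Suc sum_w_Suc wt_def fun_eq_iff less_Suc_eq)
    by simp
  subgoal using S by (auto simp: S_inter_n W_def wt_def fun_eq_iff)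
  using n by simp

lemma runs_rows:
  assumes "base \<sigma>" "reg \<sigma> 9 = B" "reg \<sigma> 13 = 0"
  shows "runs row_prog \<sigma> (40 * B) (\<lambda>\<tau>. same {11, 13} {1} \<sigma> \<tau> \<and> (\<forall>i<B. arr \<tau> 1 i = i * n))"
  unfolding row_prog_def
  apply (rule runs_For[where m = B and T = 20 and
      I = "\<lambda>i \<tau>. same {11, 13} {1} \<sigma> \<tau> \<and> base \<tau> \<and> reg \<tau> 11 = i \<and> reg \<tau> 13 = i * n \<and>
        reg \<tau> 9 = B \<and> (\<forall>j<i. arr \<tau> 1 j = j * n)"])
  using assms apply simp
    apply (simp add: base_def)
  subgoal for i \<tau>
    apply (rule runs_Seq[where T = 10 and U = 10])
     apply (rule runs_Store)
      apply (rule runs_Assign)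
    by (auto simp: base_def less_Suc_eq)
  by (auto simp: B_def)

definition "tab \<sigma> \<longleftrightarrow> base \<sigma> \<and> reg \<sigma> 8 = W \<and> reg \<sigma> 9 = B \<and> arr \<sigma> 2 = wt \<and> (\<forall>i<B. arr \<sigma> 1 i = i * n)"

lemma tab_setreg [simp]: "9 < x \<Longrightarrow> tab (setreg x a \<sigma>) = tab \<sigma>"
  by (auto simp: tab_def)

lemma tab_setcell [simp]: "2 < a \<Longrightarrow> tab (setcell a i c \<sigma>) = tab \<sigma>"
  by (auto simp: tab_def)

lemma tab_same: "tab \<sigma> \<Longrightarrow> same X A \<sigma> \<tau> \<Longrightarrow> X \<inter> {..9} = {} \<Longrightarrow> A \<inter> {..2} = {} \<Longrightarrow> tab \<tau>"
proof -
  assume a: "tab \<sigma>" "same X A \<sigma> \<tau>" "X \<inter> {..9} = {}" "A \<inter> {..2} = {}"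
  then have "reg \<tau> x = reg \<sigma> x" if "x \<le> 9" for x
    using that by (auto simp: same_def disjoint_iff)
  moreover have "arr \<tau> x = arr \<sigma> x" if "x \<le> 2" for x
    using a that by (auto simp: same_def disjoint_iff)
  ultimately show "tab \<tau>" using a(1) by (simp add: tab_def base_def)
qed

lemma runs_diagonal:
  assumes "tab \<sigma>" "arr \<sigma> 3 = (\<lambda>_. 0)"
  shows "runs diagonal_prog \<sigma> (40 * n) (\<lambda>\<tau>. same {11} {3} \<sigma> \<tau> \<and>
      (\<forall>u<n. \<forall>v<n. arr \<tau> 3 (u * n + v) = (if u = v \<and> u \<in> S then Suc b else 0)))"
  unfolding diagonal_prog_def
  apply (rule runs_For[where m = n and T = 20 and
      I = "\<lambda>i \<tau>. same {11} {3} \<sigma> \<tau> \<and> tab \<tau> \<and> reg \<tau> 11 = i \<and>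
       (\<forall>u<n. \<forall>v<n. arr \<tau> 3 (u * n + v) = (if u = v \<and> u \<in> S \<and> u < i then Suc b else 0))"])
  using assms apply simp
    apply (simp add: base_def tab_def)
  subgoal for i \<tau>
    apply (rule runs_Cond[where T = 8])
    subgoal apply (rule runs_Store)
      using inp_token[of i] by (auto simp: tab_def base_def less_Suc_eq grid_eq_iff B_def)
    subgoal apply (rule runs_Skip)
      using inp_token[of i] by (auto simp: tab_def base_def less_Suc_eq)
    by simp
  using n by simp_all

section \<open>Distances from the tokens\<close>

definition "dist_sound T \<longleftrightarrow> (\<forall>u<n. \<forall>v<n. T (u * n + v) \<le> Suc b \<and>
  (0 < T (u * n + v) \<longrightarrow> u \<in> S \<and> (u, v) \<in> R ^^ (Suc b - T (u * n + v))))"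

text \<open>For walks longer than the budget the truncated difference is 0, so nothing is claimed
  about them.\<close>

definition "dist_complete T \<longleftrightarrow> (\<forall>u\<in>S. \<forall>v<n. \<forall>l. (u, v) \<in> R ^^ l \<longrightarrow> Suc b - l \<le> T (u * n + v))"

lemma runs_dist_sweep:
  assumes "tab \<sigma>" "dist_sound (arr \<sigma> 3)"
  shows "runs (sweep 3 (Reg 10) (Reg 10) (Const 1)) \<sigma> (142 * n ^ 3)
    (\<lambda>\<tau>. same {10, 11, 12} {3} \<sigma> \<tau> \<and> dist_sound (arr \<tau> 3) \<and> (\<forall>i. arr \<sigma> 3 i \<le> arr \<tau> 3 i) \<and>
      (\<forall>u v w. u < n \<longrightarrow> v < n \<longrightarrow> w < n \<longrightarrow> (w, v) \<in> R \<longrightarrow>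
        arr \<sigma> 3 (u * n + w) - 1 \<le> arr \<tau> 3 (u * n + v)))"
proof (rule runs_sweep[where m = B])
  show "reg \<sigma> 1 = n" "n \<le> B" "\<And>i. i < B \<Longrightarrow> arr \<sigma> 1 i = i * n" "dist_sound (arr \<sigma> 3)"
    using assms by (auto simp: tab_def base_def B_def)
  show "arr \<sigma> 0 (1 + (u * n + v)) = of_bool ((u, v) \<in> R)" if "u < n" "v < n" for u v
    using assms inp_arc that by (simp add: tab_def base_def)
  show "dist_sound (T(u * n + v := max (T (u * n + v)) (T (u * n + w) - 1)))"
    if T: "dist_sound T" and uvw: "u < n" "v < n" "w < n" and wv: "(w, v) \<in> R" for T u v w
  proof -
    have uw: "T (u * n + w) \<le> Suc b" "0 < T (u * n + w) \<Longrightarrow> u \<in> S \<and> (u, w) \<in> R ^^ (Suc b - T (u * n + w))"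
      using T uvw by (simp_all add: dist_sound_def)
    have "u \<in> S \<and> (u, v) \<in> R ^^ (Suc b - (T (u * n + w) - 1))" if "0 < T (u * n + w) - 1"
    proof -
      have "Suc b - (T (u * n + w) - 1) = Suc (Suc b - T (u * n + w))" using that uw(1) by simp
      moreover have "u \<in> S" "(u, w) \<in> R ^^ (Suc b - T (u * n + w))" using that uw(2) by simp_all
      ultimately show ?thesis using wv by (metis relpow_Suc_I)
    qed
    moreover have "T (u * n + w) - 1 \<le> Suc b" using uw(1) by simp
    ultimately show ?thesis
      using T uvw unfolding dist_sound_def by (auto simp: grid_eq_iff max_def simp del: One_nat_def)
  qed
qed (use n in \<open>auto simp: B_def\<close>)

text \<open>As in the Bellman-Ford algorithm, i sweeps take care of all walks with at most i arcs. A
  shortest walk has at most \<open>card R\<close> arcs, which is at most \<open>n * n\<close> and so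
  at most \<open>L\<close>.\<close>

lemma runs_dist:
  assumes "tab \<sigma>"
    and diag: "\<forall>u<n. \<forall>v<n. arr \<sigma> 3 (u * n + v) = (if u = v \<and> u \<in> S then Suc b else 0)"
  shows "runs dist_prog \<sigma> (156 * L * n ^ 3)
    (\<lambda>\<tau>. same {10, 11, 12, 14} {3} \<sigma> \<tau> \<and> dist_sound (arr \<tau> 3) \<and> dist_complete (arr \<tau> 3))"
  unfolding dist_prog_def
proof (rule runs_For[where m = L and T = "142 * n ^ 3" and
      I = "\<lambda>i \<tau>. same {10, 11, 12, 14} {3} \<sigma> \<tau> \<and> reg \<tau> 14 = i \<and> dist_sound (arr \<tau> 3) \<and>
       (\<forall>u\<in>S. \<forall>v<n. \<forall>l\<le>i. (u, v) \<in> R ^^ l \<longrightarrow> Suc b - l \<le> arr \<tau> 3 (u * n + v))"], goal_cases)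
  case 1
  then show ?case using assms S by (auto simp: dist_sound_def)
next
  case (2 i \<tau>)
  then show ?case using tab_same[OF assms(1), of "{10, 11, 12, 14}" "{3}" \<tau>] by (simp add: tab_def base_def)
next
  case (3 i \<tau>)
  note IH = 3(2)
  from 3 have tab: "tab \<tau>" using tab_same[OF assms(1), of "{10, 11, 12, 14}" "{3}" \<tau>] by simp
  have sound: "dist_sound (arr \<tau> 3)" using IH by simp
  show ?case
  proof (rule runs_mono[OF runs_dist_sweep[OF tab sound] le_refl])
    fix \<tau>' assume new: "same {10, 11, 12} {3} \<tau> \<tau>' \<and> dist_sound (arr \<tau>' 3) \<and>
      (\<forall>i. arr \<tau> 3 i \<le> arr \<tau>' 3 i) \<and>
      (\<forall>u v w. u < n \<longrightarrow> v < n \<longrightarrow> w < n \<longrightarrow> (w, v) \<in> R \<longrightarrow>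
        arr \<tau> 3 (u * n + w) - 1 \<le> arr \<tau>' 3 (u * n + v))"
    have "Suc b - l \<le> arr \<tau>' 3 (u * n + v)"
      if l: "u \<in> S" "v < n" "l \<le> Suc i" "(u, v) \<in> R ^^ l" for u v l
    proof (cases "l \<le> i")
      case True
      then have "Suc b - l \<le> arr \<tau> 3 (u * n + v)" using IH l by blast
      then show ?thesis using new le_trans by blast
    next
      case False
      then have "l = Suc i" using l by simp
      then obtain w where w: "(u, w) \<in> R ^^ i" "(w, v) \<in> R" using l by auto
      then have "w < n" "u < n" using R S l by auto
      then have "Suc b - i \<le> arr \<tau> 3 (u * n + w)" using IH l w by blast
      moreover have "arr \<tau> 3 (u * n + w) - 1 \<le> arr \<tau>' 3 (u * n + v)"
        using new w \<open>w < n\<close> \<open>u < n\<close> l by blast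
      ultimately show ?thesis using \<open>l = Suc i\<close> by simp
    qed
    then show "reg \<tau>' 14 = i \<and> same {10, 11, 12, 14} {3} \<sigma> (setreg 14 (Suc i) \<tau>') \<and>
      reg (setreg 14 (Suc i) \<tau>') 14 = Suc i \<and> dist_sound (arr (setreg 14 (Suc i) \<tau>') 3) \<and>
      (\<forall>u\<in>S. \<forall>v<n. \<forall>l\<le>Suc i. (u, v) \<in> R ^^ l \<longrightarrow>
        Suc b - l \<le> arr (setreg 14 (Suc i) \<tau>') 3 (u * n + v))"
      using new IH by (auto simp: same_def)
  qed
next
  case (4 \<tau>)
  have "finite R" using R finite_subset by blast
  have "card R \<le> L"
    using card_mono[OF _ R] L by simp
  have "Suc b - l \<le> arr \<tau> 3 (u * n + v)" if "u \<in> S" "v < n" "(u, v) \<in> R ^^ l" for u v l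
  proof -
    \<comment> \<open>The length \<open>l\<close> may exceed the number of sweeps; the least length
      \<open>l0\<close> does not, and its slack is at least that of \<open>l\<close>.\<close>
    define l0 where "l0 = (LEAST l. (u, v) \<in> R ^^ l)"
    have l0: "(u, v) \<in> R ^^ l0" "l0 \<le> l"
      unfolding l0_def using that(3) by (rule LeastI, rule Least_le)
    from relpow_finite_bounded[OF \<open>finite R\<close>, of l] that(3)
    obtain l' where "l' \<le> card R" "(u, v) \<in> R ^^ l'" by blast
    then have "l0 \<le> L" using \<open>card R \<le> L\<close> Least_le[of "\<lambda>l. (u, v) \<in> R ^^ l" l'] unfolding l0_def by simp
    then have "Suc b - l0 \<le> arr \<tau> 3 (u * n + v)" using 4 that l0 by blast
    then show ?thesis using l0(2) by simp
  qed
  then show ?case using 4 by (simp add: dist_complete_def)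
next
  case 5
  have "1 \<le> n ^ 3" "1 \<le> L" using n L by (auto simp: Suc_le_eq intro: less_le_trans[of _ "n * n"])
  then show ?case using loop_time[of L "n ^ 3"] by simp
qed

section \<open>Cheapest plans by total weight\<close>

definition "plan_sound T \<longleftrightarrow> (\<forall>v<n. T v = 0) \<and> (\<forall>c. \<forall>v<n. T (c * n + v) \<le> Suc b \<and>
  (0 < T (c * n + v) \<longrightarrow> plan R s S w c v (Suc b - T (c * n + v))))"

text \<open>Plans on a single vertex stem from the initialization alone, so this part of
  completeness is carried through all later sweeps.\<close>

definition "start_complete \<delta> T \<longleftrightarrow> (\<forall>u\<in>S. \<delta> (u * n + s) \<le> (T (w u * n + s) :: nat))"

text \<open>Distinct ranks give distinct powers of two. This matters because the initialization
  overwrites entries instead of taking a maximum.\<close>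

lemma w_inj: "u \<in> S \<Longrightarrow> v \<in> S \<Longrightarrow> w u = w v \<Longrightarrow> u = v"
  using bij_rank by (auto simp: w_def bij_betw_def dest: inj_onD)

lemma runs_start:
  assumes tab: "tab \<sigma>" and snd: "dist_sound (arr \<sigma> 3)" and "arr \<sigma> 4 = (\<lambda>_. 0)"
  shows "runs start_prog \<sigma> (40 * n)
    (\<lambda>\<tau>. same {11} {4} \<sigma> \<tau> \<and> plan_sound (arr \<tau> 4) \<and> start_complete (arr \<tau> 3) (arr \<tau> 4))"
  unfolding start_prog_def
proof (rule runs_For[where m = n and T = 20 and
      I = "\<lambda>i \<tau>. same {11} {4} \<sigma> \<tau> \<and> reg \<tau> 11 = i \<and> plan_sound (arr \<tau> 4) \<and>
       (\<forall>u\<in>S. u < i \<longrightarrow> arr \<tau> 3 (u * n + s) \<le> arr \<tau> 4 (w u * n + s))"], goal_cases)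
  case 1
  then show ?case using assms by (auto simp: plan_sound_def)
next
  case (2 i \<tau>)
  then show ?case using tab_same[OF tab, of "{11}" "{4}" \<tau>] by (simp add: tab_def base_def)
next
  case (3 i \<tau>)
  note IH = 3(2)
  then have tab': "tab \<tau>" using tab_same[OF tab, of "{11}" "{4}" \<tau>] by simp
  have "i < B" using 3(1) by (simp add: B_def)
  let ?\<delta> = "arr \<tau> 3" and ?T = "arr \<tau> 4"
  have i\<delta>: "?\<delta> (i * n + s) \<le> Suc b"
    "0 < ?\<delta> (i * n + s) \<Longrightarrow> i \<in> S \<and> (i, s) \<in> R ^^ (Suc b - ?\<delta> (i * n + s))"
    using snd IH 3(1) s by (auto simp: dist_sound_def same_def)
  let ?T' = "?T(wt i * n + s := ?\<delta> (i * n + s))"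
  have "plan_sound ?T'"
  proof -
    \<comment> \<open>Row 0 is written only for a vertex without a token, whose weight is 0; its
      slack is 0 as well, so the row stays 0.\<close>
    have zero: "?T' v = 0" if "v < n" for v
    proof (cases "v = wt i * n + s")
      case True
      with grid_eq_iff[of v n s 0 "wt i"] that s have "wt i = 0" by simp
      then have "i \<notin> S" using w_pos[of i] by (auto simp: wt_def)
      then show ?thesis using i\<delta>(2) True by auto
    next
      case False
      then show ?thesis using IH that by (simp add: plan_sound_def)
    qed
    have "plan R s S w (wt i) s (Suc b - ?\<delta> (i * n + s))" if "0 < ?\<delta> (i * n + s)"
      using plan.start[where u = i] i\<delta>(2)[OF that] by (simp add: wt_def)
    then show ?thesis
      using IH zero i\<delta>(1) s unfolding plan_sound_def by (auto simp: grid_eq_iff)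
  qed
  moreover have "?\<delta> (u * n + s) \<le> ?T' (w u * n + s)" if u: "u \<in> S" "u < Suc i" for u
  proof (cases "u = i")
    case True
    then show ?thesis using u by (simp add: wt_def)
  next
    case False
    then have "wt i \<noteq> w u" using u w_inj[of u i] w_pos[of u] by (auto simp: wt_def)
    then show ?thesis using False u IH s by (simp add: grid_eq_iff)
  qed
  ultimately show ?case
    using IH tab' \<open>i < B\<close> wt_less_B[of i] by (intro runs_Store) (simp_all add: tab_def base_def)
next
  case (4 \<tau>)
  then show ?case using S by (auto simp: start_complete_def)
next
  case 5
  then show ?case using n by simp
qed

text \<open>A positive new candidate forces both slacks to be positive: \<open>u\<close> carries a
  token, and \<open>c\<close> exceeds its weight because row 0 is zero. Then no subtraction
  truncates, and \<open>plan.step\<close> yields a plan with exactly this slack.\<close>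

lemma plan_sound_relax:
  assumes T: "plan_sound T" and \<delta>: "dist_sound \<delta>" and uvz: "u < n" "v < n" "z < n" and arc: "(z, v) \<in> R"
  shows "plan_sound (T(c * n + v :=
    max (T (c * n + v)) (T ((c - wt u) * n + z) - (Suc b - \<delta> (u * n + v)))))"
proof -
  let ?x = "T ((c - wt u) * n + z) - (Suc b - \<delta> (u * n + v))"
  have z: "T ((c - wt u) * n + z) \<le> Suc b"
    "0 < T ((c - wt u) * n + z) \<Longrightarrow> plan R s S w (c - wt u) z (Suc b - T ((c - wt u) * n + z))"
    using T uvz by (auto simp: plan_sound_def)
  have uv: "\<delta> (u * n + v) \<le> Suc b"
    "0 < \<delta> (u * n + v) \<Longrightarrow> u \<in> S \<and> (u, v) \<in> R ^^ (Suc b - \<delta> (u * n + v))"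
    using \<delta> uvz by (auto simp: dist_sound_def)
  have pl: "c \<noteq> 0 \<and> plan R s S w c v (Suc b - ?x)" if pos: "0 < ?x"
  proof -
    have "u \<in> S" and l: "(u, v) \<in> R ^^ (Suc b - \<delta> (u * n + v))"
      using uv pos z(1) by (cases "\<delta> (u * n + v) = 0"; simp)+
    have "\<not> c \<le> w u"
    proof
      assume "c \<le> w u"
      then have "T ((c - wt u) * n + z) = 0" using T uvz \<open>u \<in> S\<close> by (simp add: wt_def plan_sound_def)
      then show False using pos by simp
    qed
    then have c: "c - wt u + w u = c" "c \<noteq> 0" using \<open>u \<in> S\<close> by (auto simp: wt_def)
    have "plan R s S w (c - wt u) z (Suc b - T ((c - wt u) * n + z))" using z(2) pos by simp
    from plan.step[OF this arc \<open>u \<in> S\<close> l] c(1)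
    have "plan R s S w c v (Suc b - T ((c - wt u) * n + z) + (Suc b - \<delta> (u * n + v)))" by simp
    moreover have "Suc b - T ((c - wt u) * n + z) + (Suc b - \<delta> (u * n + v)) = Suc b - ?x"
      using pos z(1) by simp
    ultimately show ?thesis using c(2) by simp
  qed
  have le: "?x \<le> Suc b" using z(1) by simp
  have row0: "(T(c * n + v := max (T (c * n + v)) ?x)) v' = 0" if "v' < n" for v'
  proof (cases "v' = c * n + v")
    case True
    then have "c = 0" using grid_eq_iff[of v' n v 0 c] that uvz by simp
    then have "?x = 0" using pl by blast
    then show ?thesis using True T that by (simp add: plan_sound_def)
  next
    case False
    then show ?thesis using T that by (simp add: plan_sound_def)
  qed
  show ?thesis
    unfolding plan_sound_def
  proof (intro conjI allI impI)
    fix v' assume "v' < n" then show "(T(c * n + v := max (T (c * n + v)) ?x)) v' = 0" by (rule row0)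
  next
    fix c' v' assume "v' < n"
    then show "(T(c * n + v := max (T (c * n + v)) ?x)) (c' * n + v') \<le> Suc b"
      using T le uvz by (auto simp: plan_sound_def)
  next
    fix c' v' assume v': "v' < n" and "0 < (T(c * n + v := max (T (c * n + v)) ?x)) (c' * n + v')"
    then show "plan R s S w c' v' (Suc b - (T(c * n + v := max (T (c * n + v)) ?x)) (c' * n + v'))"
      using T pl uvz(2) by (auto simp: plan_sound_def grid_eq_iff max_def)
  qed
qed

lemma runs_plan_sweep:
  assumes tab: "tab \<sigma>" and c: "reg \<sigma> 14 = c" "c < B" and \<delta>: "dist_sound (arr \<sigma> 3)"
    and T: "plan_sound (arr \<sigma> 4)"
  shows "runs (sweep 4 (Reg 14) (Sub (Reg 14) (Cell 2 (Reg 10)))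
      (Sub (Reg 4) (Cell 3 (Add (Cell 1 (Reg 10)) (Reg 11))))) \<sigma> (142 * n ^ 3)
    (\<lambda>\<tau>. same {10, 11, 12} {4} \<sigma> \<tau> \<and> plan_sound (arr \<tau> 4) \<and> (\<forall>i. arr \<sigma> 4 i \<le> arr \<tau> 4 i) \<and>
      (\<forall>u v z. u < n \<longrightarrow> v < n \<longrightarrow> z < n \<longrightarrow> (z, v) \<in> R \<longrightarrow>
        arr \<sigma> 4 ((c - wt u) * n + z) - (Suc b - arr \<sigma> 3 (u * n + v)) \<le> arr \<tau> 4 (c * n + v)))"
proof (rule runs_sweep[where m = B])
  show "reg \<sigma> 1 = n" "n \<le> B" "\<And>i. i < B \<Longrightarrow> arr \<sigma> 1 i = i * n" "plan_sound (arr \<sigma> 4)"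
    using tab T by (auto simp: tab_def base_def B_def)
  show "arr \<sigma> 0 (1 + (u * n + v)) = of_bool ((u, v) \<in> R)" if "u < n" "v < n" for u v
    using tab inp_arc that by (simp add: tab_def base_def)
  fix \<tau> u assume same: "same {10, 11, 12} {4} \<sigma> \<tau>" and u: "u < n" "reg \<tau> 10 = u"
  have tab': "tab \<tau>" using tab_same[OF tab same] by simp
  show "val \<tau> (Reg 14) = c" "val \<tau> (Sub (Reg 14) (Cell 2 (Reg 10))) = c - wt u"
    using same tab' c u by (auto simp: same_def tab_def)
  fix v assume v: "v < n" "reg \<tau> 11 = v"
  have "u < B" using u by (simp add: B_def)
  then show "val \<tau> (Sub (Reg 4) (Cell 3 (Add (Cell 1 (Reg 10)) (Reg 11)))) = Suc b - arr \<sigma> 3 (u * n + v)"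
    using same_arr[OF same, of 3] tab' u v by (simp add: tab_def base_def)
next
  show "plan_sound (T(c * n + v := max (T (c * n + v))
    (T ((c - wt u) * n + w) - (Suc b - arr \<sigma> 3 (u * n + v)))))"
    if "plan_sound T" "u < n" "v < n" "w < n" "(w, v) \<in> R" for T u v w
    using plan_sound_relax[OF that(1) \<delta> that(2-5)] .
qed (use n c in auto)

text \<open>Rows below the loop counter are complete. A plan obtained by \<open>step\<close> extends
  one of smaller weight, as weights are positive; a plan on a single vertex is covered by
  \<open>start_complete\<close>.\<close>

lemma runs_plan:
  assumes tab: "tab \<sigma>" and \<delta>: "dist_sound (arr \<sigma> 3)" "dist_complete (arr \<sigma> 3)"
    and T: "plan_sound (arr \<sigma> 4)" "start_complete (arr \<sigma> 3) (arr \<sigma> 4)"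
  shows "runs plan_prog \<sigma> (156 * B * n ^ 3) (\<lambda>\<tau>. same {10, 11, 12, 14} {4} \<sigma> \<tau> \<and>
      (arr \<tau> 4 (W * n + t) \<noteq> 0 \<longleftrightarrow> (\<exists>x\<le>b. plan R s S w W t x)))"
  unfolding plan_prog_def
proof (rule runs_For[where m = B and T = "142 * n ^ 3" and
      I = "\<lambda>i \<tau>. same {10, 11, 12, 14} {4} \<sigma> \<tau> \<and> reg \<tau> 14 = i \<and> plan_sound (arr \<tau> 4) \<and>
       start_complete (arr \<sigma> 3) (arr \<tau> 4) \<and>
       (\<forall>c<i. \<forall>v x. plan R s S w c v x \<longrightarrow> v < n \<longrightarrow> Suc b - x \<le> arr \<tau> 4 (c * n + v))"], goal_cases)
  case 1
  then show ?case using assms by auto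
next
  case (2 i \<tau>)
  then show ?case using tab_same[OF tab, of "{10, 11, 12, 14}" "{4}" \<tau>] by (simp add: tab_def base_def)
next
  case (3 i \<tau>)
  note IH = 3(2)
  from 3 have tab': "tab \<tau>" using tab_same[OF tab, of "{10, 11, 12, 14}" "{4}" \<tau>] by simp
  have arr3: "arr \<tau> 3 = arr \<sigma> 3" using IH by (simp add: same_def)
  have pre: "reg \<tau> 14 = i" "dist_sound (arr \<tau> 3)" "plan_sound (arr \<tau> 4)" using IH \<delta> arr3 by simp_all
  show ?case
  proof (rule runs_mono[OF runs_plan_sweep[OF tab' pre(1) 3(1) pre(2,3)] le_refl])
    fix \<tau>' assume new: "same {10, 11, 12} {4} \<tau> \<tau>' \<and> plan_sound (arr \<tau>' 4) \<and>
      (\<forall>i. arr \<tau> 4 i \<le> arr \<tau>' 4 i) \<and>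
      (\<forall>u v z. u < n \<longrightarrow> v < n \<longrightarrow> z < n \<longrightarrow> (z, v) \<in> R \<longrightarrow>
        arr \<tau> 4 ((i - wt u) * n + z) - (Suc b - arr \<tau> 3 (u * n + v)) \<le> arr \<tau>' 4 (i * n + v))"
    have start: "start_complete (arr \<sigma> 3) (arr \<tau>' 4)"
      using new IH unfolding start_complete_def by (meson le_trans)
    have "Suc b - x \<le> arr \<tau>' 4 (c * n + v)"
      if pl: "c < Suc i" "plan R s S w c v x" "v < n" for c v x
    proof (cases "c < i")
      case True
      then have "Suc b - x \<le> arr \<tau> 4 (c * n + v)" using IH pl by blast
      then show ?thesis using new le_trans by blast
    next
      case False
      then have "c = i" using pl by simp
      from pl(2) show ?thesis
      proof cases
        case (start u)
        then have "Suc b - x \<le> arr \<sigma> 3 (u * n + s)" using \<delta>(2) pl by (auto simp: dist_complete_def)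
        also have "\<dots> \<le> arr \<tau>' 4 (w u * n + s)"
          using \<open>start_complete (arr \<sigma> 3) (arr \<tau>' 4)\<close> start by (simp add: start_complete_def)
        finally show ?thesis using start by simp
      next
        case (step c' z y u l)
        have "z < n" "u < n" using step R S by auto
        have "c' < i" using step \<open>c = i\<close> w_pos[of u] by simp
        then have "Suc b - y \<le> arr \<tau> 4 (c' * n + z)" using IH step \<open>z < n\<close> by blast
        moreover have "i - wt u = c'" using step \<open>c = i\<close> by (simp add: wt_def)
        moreover have "arr \<tau> 4 ((i - wt u) * n + z) - (Suc b - arr \<tau> 3 (u * n + v)) \<le> arr \<tau>' 4 (i * n + v)"
          using new \<open>z < n\<close> \<open>u < n\<close> pl(3) step by blast
        moreover have "Suc b - l \<le> arr \<tau> 3 (u * n + v)"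
          using \<delta>(2) step pl(3) arr3 by (auto simp: dist_complete_def)
        ultimately show ?thesis using \<open>c = i\<close> step by simp
      qed
    qed
    then show "reg \<tau>' 14 = i \<and> same {10, 11, 12, 14} {4} \<sigma> (setreg 14 (Suc i) \<tau>') \<and>
      reg (setreg 14 (Suc i) \<tau>') 14 = Suc i \<and> plan_sound (arr (setreg 14 (Suc i) \<tau>') 4) \<and>
      start_complete (arr \<sigma> 3) (arr (setreg 14 (Suc i) \<tau>') 4) \<and>
      (\<forall>c<Suc i. \<forall>v x. plan R s S w c v x \<longrightarrow> v < n \<longrightarrow>
        Suc b - x \<le> arr (setreg 14 (Suc i) \<tau>') 4 (c * n + v))"
      using new IH start by (auto simp: same_def)
  qed
next
  case (4 \<tau>)
  have "W < B" by (simp add: B_def)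
  have sound: "arr \<tau> 4 (W * n + t) \<le> Suc b"
    "0 < arr \<tau> 4 (W * n + t) \<Longrightarrow> plan R s S w W t (Suc b - arr \<tau> 4 (W * n + t))"
    using 4 t by (auto simp: plan_sound_def)
  \<comment> \<open>Slack is counted from \<open>Suc b\<close>, so it is nonzero exactly for costs
    at most \<open>b\<close>; this is why the answer is a test against 0.\<close>
  have "Suc b - x \<le> arr \<tau> 4 (W * n + t)" if "plan R s S w W t x" for x
    using 4 \<open>W < B\<close> t that by blast
  moreover have "\<exists>x\<le>b. plan R s S w W t x" if "arr \<tau> 4 (W * n + t) \<noteq> 0"
    using that sound(2) by (intro exI[of _ "Suc b - arr \<tau> 4 (W * n + t)"]) simp
  ultimately show ?case using 4 by fastforce
next
  case 5
  have "1 \<le> n ^ 3" "1 \<le> B" using n by (simp_all add: B_def Suc_le_eq)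
  then show ?case using loop_time[of B "n ^ 3"] by simp
qed

section \<open>Composition of the phases\<close>

lemma runs_spd_prog:
  assumes "runs setup_prog \<sigma> 34 (\<lambda>\<tau>. base \<tau> \<and> reg \<tau> 6 = 1 \<and> reg \<tau> 7 = 1 \<and> reg \<tau> 8 = 0 \<and>
    reg \<tau> 13 = 0 \<and> (\<forall>a>0. arr \<tau> a = (\<lambda>_. 0)))"
  shows "runs spd_prog \<sigma> (150 * n + 40 * B + 156 * L * n ^ 3 + 156 * B * n ^ 3 + 48)
    (\<lambda>\<tau>. result \<tau> = (if \<exists>x\<le>b. plan R s S w W t x then 1 else 0))"
proof -
  let ?diag = "\<lambda>T. \<forall>u<n. \<forall>v<n. T (u * n + v) = (if u = v \<and> u \<in> S then Suc b else (0 :: nat))"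
  let ?yes = "\<exists>x\<le>b. plan R s S w W t x"
  have "runs power_prog \<tau> (30 * n) (\<lambda>\<tau>. base \<tau> \<and> reg \<tau> 6 = 2 ^ k \<and> reg \<tau> 7 = 1 \<and> reg \<tau> 8 = 0 \<and>
      reg \<tau> 13 = 0 \<and> (\<forall>a>0. arr \<tau> a = (\<lambda>_. 0)))"
    if "base \<tau> \<and> reg \<tau> 6 = 1 \<and> reg \<tau> 7 = 1 \<and> reg \<tau> 8 = 0 \<and> reg \<tau> 13 = 0 \<and>
      (\<forall>a>0. arr \<tau> a = (\<lambda>_. 0))" for \<tau>
    using that by (intro runs_mono[OF runs_token_powers le_refl]) (auto simp: same_def base_def)
  note 1 = runs_SeqI[OF assms this]
  have "runs weight_prog \<tau> (40 * n) (\<lambda>\<tau>. base \<tau> \<and> reg \<tau> 8 = W \<and> arr \<tau> 2 = wt \<and>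
      reg \<tau> 13 = 0 \<and> arr \<tau> 3 = (\<lambda>_. 0) \<and> arr \<tau> 4 = (\<lambda>_. 0))"
    if "base \<tau> \<and> reg \<tau> 6 = 2 ^ k \<and> reg \<tau> 7 = 1 \<and> reg \<tau> 8 = 0 \<and> reg \<tau> 13 = 0 \<and>
      (\<forall>a>0. arr \<tau> a = (\<lambda>_. 0))" for \<tau>
    using that by (intro runs_mono[OF runs_weights le_refl]) (auto simp: same_def base_def)
  note 2 = runs_SeqI[OF 1 this]
  have "runs (Assign 9 (Add (Reg 8) (Add (Reg 1) (Const 1)))) \<tau> 6 (\<lambda>\<tau>. base \<tau> \<and> reg \<tau> 8 = W \<and>
      reg \<tau> 9 = B \<and> arr \<tau> 2 = wt \<and> reg \<tau> 13 = 0 \<and> arr \<tau> 3 = (\<lambda>_. 0) \<and> arr \<tau> 4 = (\<lambda>_. 0))"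
    if "base \<tau> \<and> reg \<tau> 8 = W \<and> arr \<tau> 2 = wt \<and> reg \<tau> 13 = 0 \<and> arr \<tau> 3 = (\<lambda>_. 0) \<and>
      arr \<tau> 4 = (\<lambda>_. 0)" for \<tau>
    using that by (intro runs_Assign) (auto simp: base_def B_def)
  note 3 = runs_SeqI[OF 2 this]
  have "runs row_prog \<tau> (40 * B) (\<lambda>\<tau>. tab \<tau> \<and> arr \<tau> 3 = (\<lambda>_. 0) \<and> arr \<tau> 4 = (\<lambda>_. 0))"
    if "base \<tau> \<and> reg \<tau> 8 = W \<and> reg \<tau> 9 = B \<and> arr \<tau> 2 = wt \<and> reg \<tau> 13 = 0 \<and>
      arr \<tau> 3 = (\<lambda>_. 0) \<and> arr \<tau> 4 = (\<lambda>_. 0)" for \<tau>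
    using that by (intro runs_mono[OF runs_rows le_refl]) (auto simp: same_def base_def tab_def)
  note 4 = runs_SeqI[OF 3 this]
  have "runs diagonal_prog \<tau> (40 * n) (\<lambda>\<tau>. tab \<tau> \<and> ?diag (arr \<tau> 3) \<and> arr \<tau> 4 = (\<lambda>_. 0))"
    if "tab \<tau> \<and> arr \<tau> 3 = (\<lambda>_. 0) \<and> arr \<tau> 4 = (\<lambda>_. 0)" for \<tau>
    using that tab_same[of \<tau> "{11}" "{3}"]
    by (intro runs_mono[OF runs_diagonal le_refl]) (auto simp: same_arr)
  note 5 = runs_SeqI[OF 4 this]
  have "runs dist_prog \<tau> (156 * L * n ^ 3) (\<lambda>\<tau>. tab \<tau> \<and> dist_sound (arr \<tau> 3) \<and>
      dist_complete (arr \<tau> 3) \<and> arr \<tau> 4 = (\<lambda>_. 0))"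
    if "tab \<tau> \<and> ?diag (arr \<tau> 3) \<and> arr \<tau> 4 = (\<lambda>_. 0)" for \<tau>
    using that tab_same[of \<tau> "{10, 11, 12, 14}" "{3}"]
    by (intro runs_mono[OF runs_dist le_refl]) (auto simp: same_arr)
  note 6 = runs_SeqI[OF 5 this]
  have "runs start_prog \<tau> (40 * n) (\<lambda>\<tau>. tab \<tau> \<and> dist_sound (arr \<tau> 3) \<and> dist_complete (arr \<tau> 3) \<and>
      plan_sound (arr \<tau> 4) \<and> start_complete (arr \<tau> 3) (arr \<tau> 4))"
    if "tab \<tau> \<and> dist_sound (arr \<tau> 3) \<and> dist_complete (arr \<tau> 3) \<and> arr \<tau> 4 = (\<lambda>_. 0)" for \<tau>
  proof (rule runs_mono[OF runs_start le_refl])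
    fix \<tau>' assume \<tau>': "same {11} {4} \<tau> \<tau>' \<and> plan_sound (arr \<tau>' 4) \<and>
      start_complete (arr \<tau>' 3) (arr \<tau>' 4)"
    then have "arr \<tau>' 3 = arr \<tau> 3" by (simp add: same_def)
    then show "tab \<tau>' \<and> dist_sound (arr \<tau>' 3) \<and> dist_complete (arr \<tau>' 3) \<and>
      plan_sound (arr \<tau>' 4) \<and> start_complete (arr \<tau>' 3) (arr \<tau>' 4)"
      using that \<tau>' tab_same[of \<tau> "{11}" "{4}" \<tau>'] by simp
  qed (use that in auto)
  note 7 = runs_SeqI[OF 6 this]
  have "runs plan_prog \<tau> (156 * B * n ^ 3) (\<lambda>\<tau>. tab \<tau> \<and> (arr \<tau> 4 (W * n + t) \<noteq> 0 \<longleftrightarrow> ?yes))"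
    if "tab \<tau> \<and> dist_sound (arr \<tau> 3) \<and> dist_complete (arr \<tau> 3) \<and>
      plan_sound (arr \<tau> 4) \<and> start_complete (arr \<tau> 3) (arr \<tau> 4)" for \<tau>
    using that tab_same[of \<tau> "{10, 11, 12, 14}" "{4}"]
    by (intro runs_mono[OF runs_plan le_refl]) auto
  note 8 = runs_SeqI[OF 7 this]
  have "runs output_prog \<tau> 8 (\<lambda>\<tau>. result \<tau> = (if ?yes then 1 else 0))"
    if \<tau>: "tab \<tau> \<and> (arr \<tau> 4 (W * n + t) \<noteq> 0 \<longleftrightarrow> ?yes)" for \<tau>
  proof -
    have "val \<tau> (Cell 4 (Add (Cell 1 (Reg 8)) (Reg 3))) = arr \<tau> 4 (W * n + t)"
      using \<tau> by (simp add: tab_def base_def B_def)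
    with \<tau> show ?thesis
      unfolding output_prog_def by (intro runs_Cond[where T = 2] runs_Assign) (auto simp: result_def)
  qed
  note 9 = runs_SeqI[OF 8 this]
  show ?thesis unfolding spd_prog_def by (rule runs_mono[OF 9]) simp_all
qed

end

section \<open>Input and running time\<close>

lemma nth_grid:
  assumes "u < m" "v < n"
  shows "concat (map (\<lambda>u. map (f u) [0..<n]) [0..<m]) ! (u * n + v) = f u v"
  using assms
proof (induction m)
  case (Suc m)
  have len: "length (concat (map (\<lambda>u. map (f u) [0..<n]) [0..<m])) = m * n" for m
    by (induction m) (simp_all add: length_concat)
  show ?case
  proof (cases "u < m")
    case True
    then have "u * n + v < m * n"
      using Suc.prems(2) mult_le_mono1[of "Suc u" m n] by simp
    then show ?thesis using Suc.IH True Suc.prems(2) by (simp add: nth_append len)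
  next
    case False
    then have "u = m" using Suc.prems by simp
    then show ?thesis using Suc.prems(2) by (simp add: nth_append len)
  qed
qed simp

lemma length_grid: "length (concat (map (\<lambda>u. map (f u) [0..<n]) [0..<m])) = m * n"
  by (induction m) simp_all

lemma length_le_input_size: "length xs \<le> input_size xs"
  unfolding input_size_def by (induction xs) simp_all

lemma computable_exp: "computable (\<lambda>k. a * 4 ^ k)"
  unfolding computable_def
proof (rule exI, rule allI)
  fix k
  let ?c = "Seq (Assign 2 (Cell 0 (Const 0))) (Seq (Assign 0 (Const a))
    (For 1 2 (Assign 0 (Add (Add (Reg 0) (Reg 0)) (Add (Reg 0) (Reg 0))))))"
  have "runs ?c (init [k]) (3 + (2 + (k * (8 + 8) + 6))) (\<lambda>\<sigma>. result \<sigma> = a * 4 ^ k)"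
    apply (rule runs_Seq[where T = 3 and U = "k * 16 + 8"], rule runs_Assign)
      apply (rule runs_Seq[where T = 2 and U = "k * 16 + 6"], rule runs_Assign)
        apply (rule runs_For[where m = k and T = 8 and
          I = "\<lambda>i \<sigma>. reg \<sigma> 0 = a * 4 ^ i \<and> reg \<sigma> 1 = i \<and> reg \<sigma> 2 = k"])
            apply (simp add: init_def)
           apply simp
          apply (rule runs_Assign)
           apply (simp_all add: init_def)
    by (simp add: result_def)
  then show "\<exists>t \<sigma>. exec ?c (init [k]) t \<sigma> \<and> result \<sigma> = a * 4 ^ k"
    unfolding runs_def by blast
qed

text \<open>From \<open>k + 1 \<le> 2 ^ k\<close> follows \<open>W < 4 ^ k\<close>, hence
  \<open>B \<le> 2 * 4 ^ k * N\<close>. Cubic sweeps repeated \<open>L\<close> or \<open>B\<close>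
  times give the fourth power. Each term is a multiple of \<open>X = 4 ^ k * N ^ 4\<close>, with
  coefficients adding up to 746.\<close>

lemma spd_time_bound:
  fixes n N B L k W :: nat
  assumes "1 \<le> n" "n \<le> N" "L \<le> N" "W + 1 = (k + 1) * 2 ^ k"
  defines "B \<equiv> W + n + 1"
  shows "150 * n + 40 * B + 156 * L * n ^ 3 + 156 * B * n ^ 3 + 48 \<le> 1000 * 4 ^ k * N ^ 4"
proof -
  define Z :: nat where "Z = 4 ^ k"
  have N: "1 \<le> N" using assms by simp
  have Z: "1 \<le> Z" by (simp add: Z_def)
  have "k + 1 \<le> 2 ^ k" by (induction k) simp_all
  then have "W + 1 \<le> 2 ^ k * 2 ^ k" unfolding assms(4) by (rule mult_le_mono1)
  then have "W + 1 \<le> Z" by (simp add: Z_def flip: power_mult_distrib)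
  moreover have "Z \<le> Z * N" using N by simp
  moreover have "n \<le> Z * N" using assms(2) Z mult_le_mono[of 1 Z n N] by simp
  ultimately have "B \<le> Z * N + Z * N" unfolding B_def by linarith
  then have B: "B \<le> 2 * (Z * N)" by simp
  have n3: "n ^ 3 \<le> N ^ 3" using assms(2) by (rule power_mono) simp
  define X where "X = Z * N ^ 4"
  have N4: "N * N ^ 3 = N ^ 4" by (simp add: eval_nat_numeral)
  have "1 \<le> N ^ 4" using N by simp
  then have X1: "1 \<le> X" using Z mult_le_mono[of 1 Z 1 "N ^ 4"] by (simp add: X_def)
  have "N * 1 \<le> N * N ^ 3" using N by (intro mult_le_mono) simp_all
  then have "Z * N \<le> X" using N4 by (simp add: X_def)
  moreover have "N \<le> Z * N" using Z by simp
  ultimately have XN: "n \<le> X" "B \<le> 2 * X" using assms(2) B by linarith+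
  have "L * n ^ 3 \<le> N * N ^ 3" using assms(3) n3 by (rule mult_le_mono)
  then have XL: "L * n ^ 3 \<le> X" using Z N4 mult_le_mono[of 1 Z "L * n ^ 3" "N ^ 4"] by (simp add: X_def)
  have "B * n ^ 3 \<le> 2 * (Z * N) * N ^ 3" using B n3 by (rule mult_le_mono)
  also have "\<dots> = 2 * X" using N4 by (simp add: X_def algebra_simps)
  finally have "B * n ^ 3 \<le> 2 * X" .
  then have "150 * n + 40 * B + 156 * (L * n ^ 3) + 156 * (B * n ^ 3) + 48 \<le> 1000 * X"
    using X1 XN XL by linarith
  then show ?thesis by (simp add: X_def Z_def mult.assoc)
qed

theorem theorem4p3:
  shows "fixed_parameter_tractable spd_input spd_encode spd_parameter spd_yes"
  unfolding fixed_parameter_tractable_def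
proof (rule exI[of _ spd_prog], rule exI[of _ "\<lambda>k. 1000 * 4 ^ k"], rule exI[of _ 4],
    intro conjI allI impI)
  show "computable (\<lambda>k. 1000 * 4 ^ k)" by (rule computable_exp)
  fix I assume "spd_input I"
  then obtain n where inst: "spd_instance I" and verts: "pverts (graph_of I) = {0..<n}"
    by (auto simp: spd_input_def)
  define xs where "xs = spd_encode I"
  define R where "R = parcs (graph_of I)"
  define S where "S = start I"
  define grid :: "nat list"
    where "grid = concat (map (\<lambda>u. map (\<lambda>v. of_bool ((u, v) \<in> R)) [0..<n]) [0..<n])"
  define toks :: "nat list" where "toks = map (\<lambda>v. of_bool (v \<in> S)) [0..<n]"
  interpret G: pair_graph "graph_of I" using inst by (simp add: spd_instance_def)
  have xs: "xs = n # grid @ source I # target I # toks @ [budget I]"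
    by (simp add: xs_def spd_encode_def verts Let_def grid_def toks_def R_def S_def)
  have lens: "length grid = n * n" "length toks = n"
    by (simp_all add: grid_def toks_def length_grid)
  define L where "L = length xs"
  have L_eq: "L = n * n + n + 4" by (simp add: L_def xs lens)
  define inp where "inp = arr (init xs) 0"
  have inp: "inp i = (if i < L then xs ! i else 0)" for i
    by (simp add: inp_def init_def L_def)
  have st: "source I < n" "target I < n" "S \<subseteq> {..<n}" "R \<subseteq> {..<n} \<times> {..<n}"
    using inst G.wellformed' by (auto simp: spd_instance_def verts S_def R_def)
  have arc: "inp (1 + (u * n + v)) = of_bool ((u, v) \<in> R)" if "u < n" "v < n" for u v
  proof -
    have "u * n + v < n * n" using that mult_le_mono1[of "Suc u" n n] by simp
    then show ?thesis
      using nth_grid[OF that, of "\<lambda>u v. of_bool ((u, v) \<in> R)"] L_eq lens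
      by (simp add: inp xs nth_append grid_def)
  qed
  define tb where "tb = L - n - 1"
  have token: "inp (tb + v) = of_bool (v \<in> S)" if "v < n" for v
    using that L_eq lens by (simp add: inp xs nth_append nth_Cons' toks_def tb_def)
  \<comment> \<open>The machine cannot multiply, so whatever lies behind the matrix is addressed
    from the end of the input: the budget last, the \<open>n\<close> token entries before it, and
    \<open>t\<close> and \<open>s\<close> before those.\<close>
  have others: "inp 0 = n" "inp (L - n - 3) = source I" "inp (L - n - 2) = target I"
    "inp (L - 1) = budget I"
    using L_eq lens by (simp_all add: inp xs nth_append nth_Cons')
  interpret spd_data n "source I" "target I" "budget I" L tb S R inp
    using st arc token L_eq by unfold_locales (auto simp: tb_def)
  have yes: "spd_yes I \<longleftrightarrow> (\<exists>x\<le>budget I. plan R (source I) S w W (target I) x)"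
    using spd_yes_iff_plan[OF inst, of rank k] bij_rank
    by (simp add: S_def[symmetric] R_def[symmetric] W_def w_def[abs_def])
  have W: "W + 1 = (k + 1) * 2 ^ k"
    using sum_weights[OF bij_rank] by (simp add: W_def w_def)
  have init: "reg (init xs) = (\<lambda>_. 0)(0 := L)" "arr (init xs) = (\<lambda>_ _. 0)(0 := inp)"
    by (simp_all add: inp_def init_def L_def)
  have "runs setup_prog (init xs) 34 (\<lambda>\<sigma>. base \<sigma> \<and> reg \<sigma> 6 = 1 \<and> reg \<sigma> 7 = 1 \<and> reg \<sigma> 8 = 0 \<and>
      reg \<sigma> 13 = 0 \<and> (\<forall>a>0. arr \<sigma> a = (\<lambda>_. 0)))"
    unfolding setup_prog_def
    apply (rule runs_Seq[where T = 3 and U = 31], rule runs_Assign)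
      apply (rule runs_Seq[where T = 7 and U = 24], rule runs_Assign)
        apply (rule runs_Seq[where T = 7 and U = 17], rule runs_Assign)
          apply (rule runs_Seq[where T = 7 and U = 10], rule runs_Assign)
            apply (rule runs_Seq[where T = 6 and U = 4], rule runs_Assign)
              apply (rule runs_Seq[where T = 2 and U = 2], rule runs_Assign)
                apply (rule runs_Assign)
    using others tb_def[symmetric] by (simp_all add: base_def init)
  from runs_spd_prog[OF this]
  have "runs spd_prog (init xs) (1000 * 4 ^ k * input_size xs ^ 4)
      (\<lambda>\<tau>. result \<tau> = (if spd_yes I then 1 else 0))"
    unfolding yes
  proof (rule runs_mono)
    have "L \<le> input_size xs" using length_le_input_size by (simp add: L_def)
    then show "150 * n + 40 * B + 156 * L * n ^ 3 + 156 * B * n ^ 3 + 48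
        \<le> 1000 * 4 ^ k * input_size xs ^ 4"
      unfolding B_def using n L_eq by (intro spd_time_bound[OF _ _ _ W]) simp_all
  qed
  moreover have "k = spd_parameter I" by (simp only: k_def) (simp add: spd_parameter_def S_def)
  ultimately show "\<exists>t \<sigma>. exec spd_prog (init (spd_encode I)) t \<sigma> \<and>
      t \<le> 1000 * 4 ^ spd_parameter I * input_size (spd_encode I) ^ 4 \<and>
      result \<sigma> = (if spd_yes I then 1 else 0)"
    by (simp only: runs_def xs_def)
qed

end
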